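(* Let $C_\star<\infty$ be an absolute constant as fixed in the context. There are absolute constants $L_0,c_0,C',C_2$, with $$C_2=\frac{2\ln51-\ln(4\pi^2)}{\pi^2}+C_\star,$$ such that for all $c\ge c_0$ and all $\delta\in(0,\tfrac12)$ with $L_0\le L=\ln\frac1\delta\le c^{1/3}$, $$D(\delta,c)\ \le\ \frac{L}{\pi^2}\bigl(\ln c+\ln L\bigr)+C_2\,L+C'\ln c.$$ Consequently, for every $\eta\in(0,1)$ there are $c_0(\eta)$ and $C_\eta<\infty$ such that for all $c\ge c_0(\eta)$ and all $\delta$ with $L_0\le L\le c^{1/3}$ and $L\le c^{\eta/2}$, $$D(\delta,c)\ \le\ (1+\eta)\,\frac{L}{\pi^2}\,\ln c+C_\eta\ln c.$$
   Context: For $c>0$, $S_c$ is the positive trace-class integral operator on $L^2(0,c)$ with kernel $\frac{\sin(\pi(x-y))}{\pi(x-y)}$ (equal to $1$ for $x=y$); its eigenvalues are simple, $1>\lambda_0(c)>\lambda_1(c)>\cdots>0$. For $0<\delta<\tfrac12$ put $L=\ln\frac1\delta$, $\bar L=\ln\frac{1-\delta}{\delta}$, $$\Lambda^+_\delta(c)=\#\{n:\tfrac12<\lambda_n(c)\le1-\delta\},\qquad D(\delta,c)=\#\{n:\delta<\lambda_n(c)\le\tfrac12\}.$$ The constant $C_\star$: the paper's head-side theorem supplies absolute constants $C_\star,c_{\mathrm h}<\infty$ such that $$\Bigl|\Lambda^+_\delta(c)-\frac{L}{\pi^2}\ln\frac{4\pi^2c}{L}\Bigr|\le C_\star(\ln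 c+L)\qquad\text{for all }c\ge c_{\mathrm h}\text{ and }6\le\bar L\le c^{1/3};$$ fix such constants. $\ln$ is the natural logarithm. *)

theory Defs
  imports "HOL-Analysis.Analysis"
begin

abbreviation interval_meas :: "real \<Rightarrow> real measure"
  where "interval_meas c \<equiv> restrict_space lborel {0<..<c}"

text \<open>Representatives of the elements of complex \<open>L\<^sup>2(0,c)\<close>; two of them are identified when they
  agree almost everywhere.\<close>

definition L2_fun :: "real \<Rightarrow> (real \<Rightarrow> complex) set"
  where "L2_fun c = {f \<in> borel_measurable (interval_meas c).
                       integrable (interval_meas c) (\<lambda>x. (cmod (f x))\<^sup>2)}"

definition sine_kernel :: "real \<Rightarrow> real \<Rightarrow> real"
  where "sine_kernel x y = (if x = y then 1 else sin (pi * (x - y)) / (pi * (x - y)))"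

definition sine_op :: "real \<Rightarrow> (real \<Rightarrow> complex) \<Rightarrow> real \<Rightarrow> complex"
  where "sine_op c f x = (LINT y | interval_meas c. complex_of_real (sine_kernel x y) * f y)"

definition sine_eigenvalue :: "real \<Rightarrow> complex \<Rightarrow> bool"
  where "sine_eigenvalue c \<mu> \<longleftrightarrow>
    (\<exists>f \<in> L2_fun c. \<not> (AE x in interval_meas c. f x = 0) \<and>
                     (AE x in interval_meas c. sine_op c f x = \<mu> * f x))"

text \<open>The operator is positive and all its eigenvalues are real and simple, so enumerating them in
  decreasing order with multiplicity is the same as enumerating the distinct real eigenvalues:
  \<open>lam c n\<close> is the eigenvalue with exactly \<open>n\<close> eigenvalues above it. The finiteness condition is
  needed because \<open>card\<close> is \<open>0\<close> on infinite sets.\<close>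

definition lam :: "real \<Rightarrow> nat \<Rightarrow> real"
  where "lam c n = (THE \<mu>. sine_eigenvalue c (complex_of_real \<mu>) \<and>
      finite {\<nu>. \<mu> < \<nu> \<and> sine_eigenvalue c (complex_of_real \<nu>)} \<and>
      card {\<nu>. \<mu> < \<nu> \<and> sine_eigenvalue c (complex_of_real \<nu>)} = n)"

text \<open>For \<open>c > 0\<close> and \<open>\<delta> > 0\<close> both index sets below are finite, since \<open>lam c\<close> decreases to \<open>0\<close>.\<close>

definition Lambda_plus :: "real \<Rightarrow> real \<Rightarrow> nat"
  where "Lambda_plus \<delta> c = card {n. 1/2 < lam c n \<and> lam c n \<le> 1 - \<delta>}"

definition D_count :: "real \<Rightarrow> real \<Rightarrow> nat"
  where "D_count \<delta> c = card {n. \<delta> < lam c n \<and> lam c n \<le> 1/2}"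

definition Log_inv :: "real \<Rightarrow> real"
  where "Log_inv \<delta> = ln (1 / \<delta>)"

definition Log_odds :: "real \<Rightarrow> real"
  where "Log_odds \<delta> = ln ((1 - \<delta>) / \<delta>)"

end

theory Submission
  imports Defs "HOL-Probability.Probability" "HOL-Computational_Algebra.Polynomial"
begin

text \<open>
  The head-side estimate bounds \<open>\<Lambda>\<^sup>+\<close> from below, so it suffices to bound the number of all
  eigenvalues in \<open>(\<delta>, 1 - \<delta>]\<close> by \<open>(2 L / \<pi>\<^sup>2) ln (51 c) + O(ln c)\<close>.

  Let \<open>P\<close> be convolution with the sinc kernel, the projection onto the band-limited functions. For a
  combination \<open>f\<close> of eigenfunctions with eigenvalues in \<open>(\<delta>, 1 - \<delta>]\<close>, the energy of \<open>P f\<close> outside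
  \<open>(0, c)\<close> is \<open>\<langle>(S - S\<^sup>2) f, f\<rangle> \<ge> \<delta> (1 - \<delta>) \<parallel>f\<parallel>\<^sup>2\<close>. On the other hand it is smaller than that as soon as \<open>f\<close>
  satisfies few enough linear conditions. On the two end intervals of length 2 the sinc kernel is
  approximated by its Taylor polynomial, which costs \<open>O(L)\<close> conditions with a small constant. On
  \<open>[2, c - 2]\<close> the factor \<open>1 / (x - y)\<close> of the kernel is multiplied by \<open>\<phi> x / \<phi> y\<close> for a rational function
  \<open>\<phi>\<close> of degree \<open>k\<close> that is small on \<open>[2, c - 2]\<close> and large off \<open>(0, c)\<close>. This changes the kernel by one of
  rank \<open>2 k\<close>, and for the (nearly) optimal \<open>\<phi>\<close> of Zolotarev's problem \<open>2 k\<close> is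
  \<open>(2 L / \<pi>\<^sup>2) ln c + O(L + ln c)\<close>.
\<close>

section \<open>Rational functions separating two intervals\<close>

text \<open>The total count contributes (2 L / pi^2) ln c, twice the claimed leading term.
  Subtracting the head-side lower bound removes (L / pi^2) (ln c - ln L + ln (4 pi^2)), which is why
  ln L enters the result with a plus sign and ln (4 pi^2) with a minus sign. The obstacle is that no
  rational function is small on (0, c) and large on its whole complement: the two sets share
  endpoints. Gaps of fixed length 2 keep the logarithmic length of the separation problem at 2 ln (c
  - 1), while the end pieces so released cost only a multiple of L. The separation factor eps enters
  once at x and once at y, and energy is quadratic, so the middle piece leaks at most eps^4. With
  eps about exp (- pi^2 n / (4 ln c)), the demand that eps^4 be about delta gives n about L ln c /
  pi^2; the sine and cosine parts of sin (pi (x - y)) double it. The number 51 is slack: the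
  remaining terms linear in L, from repeated end nodes and from Taylor conditions, fit below (2 L /
  pi^2) ln 51 because ln 51 >= 3.\<close>

lemma cayley_le_exp_artanh_partial_sum:
  fixes z :: real
  assumes "0 \<le> z" "z \<le> 1"
  shows "(1 - z) / (1 + z) \<le> exp (- 2 * (\<Sum>i<I. z ^ (2*i+1) / real (2*i+1)))"
proof (cases "z = 1")
  case False
  with assms have z: "0 \<le> z" "z < 1" by auto
  \<comment> \<open>\<open>F\<close> is 2 artanh minus a partial sum of its Taylor series. Its
    derivative is twice the tail of a geometric series, hence nonnegative. Staying with partial sums
    keeps every later exchange of summations finite.\<close>
  define F where "F = (\<lambda>t::real. ln (1 + t) - ln (1 - t) - 2 * (\<Sum>i<I. t ^ (2*i+1) / real (2*i+1)))"
  have "F 0 \<le> F z"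
  proof (rule DERIV_nonneg_imp_nondecreasing[OF z(1)])
    fix t :: real assume t: "0 \<le> t" "t \<le> z"
    have S: "((\<lambda>t. \<Sum>i<I. t ^ (2*i+1) / real (2*i+1)) has_real_derivative (\<Sum>i<I. (t^2)^i)) (at t)"
    proof (rule DERIV_sum)
      fix i
      show "((\<lambda>t. t ^ (2*i+1) / real (2*i+1)) has_real_derivative ((t^2)^i)) (at t)"
        by (rule derivative_eq_intros refl | simp)+ (simp add: power_mult divide_simps)
    qed
    have "(F has_real_derivative 1 / (1 + t) + 1 / (1 - t) - 2 * (\<Sum>i<I. (t^2)^i)) (at t)"
      unfolding F_def using t z
      by (intro DERIV_diff DERIV_cmult S) (auto intro!: derivative_eq_intros)
    moreover have "(\<Sum>i<I. (t^2)^i) \<le> 1 / (1 - t^2)"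
    proof -
      have lt: "t^2 < 1" using t z by (simp add: power_less_one_iff abs_square_less_1)
      have "(\<Sum>i<I. (t^2)^i) = (1 - (t^2)^I) / (1 - t^2)"
        using lt sum_gp_strict[of "t^2" I] by auto
      also have "\<dots> \<le> 1 / (1 - t^2)"
        using lt by (intro divide_right_mono) auto
      finally show ?thesis .
    qed
    moreover have "1 / (1 + t) + 1 / (1 - t) = 2 * (1 / (1 - t^2))"
    proof -
      have "1 + t \<noteq> 0" "1 - t \<noteq> 0" "1 - t^2 = (1 + t) * (1 - t)" using t z by (auto simp: power2_eq_square algebra_simps)
      then show ?thesis by (simp add: divide_simps)
    qed
    ultimately show "\<exists>y. (F has_real_derivative y) (at t) \<and> 0 \<le> y"
      by (smt (verit))
  qed
  then have "2 * (\<Sum>i<I. z ^ (2*i+1) / real (2*i+1)) \<le> ln (1 + z) - ln (1 - z)"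
    by (simp add: F_def)
  then have "ln ((1 - z) / (1 + z)) \<le> - 2 * (\<Sum>i<I. z ^ (2*i+1) / real (2*i+1))"
    using z by (simp add: ln_div)
  moreover have "0 < (1 - z) / (1 + z)" using z by simp
  ultimately show ?thesis by (metis exp_ln exp_le_cancel_iff)
qed auto

text \<open>The Basel sum minus its even part, pi^2/6 - pi^2/24, obtained by grouping the terms in
  pairs.\<close>

lemma sum_inverse_odd_squares: "(\<lambda>i. 1 / (real (2*i+1))\<^sup>2) sums (pi\<^sup>2 / 8)"
proof -
  let ?f = "\<lambda>n::nat. 1 / (real n + 1)\<^sup>2"
  have f: "?f sums (pi\<^sup>2 / 6)" using inverse_squares_sums by (simp add: add.commute)
  have "(\<lambda>n. sum ?f {n * 2..<n * 2 + 2}) sums (pi\<^sup>2 / 6)"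
    by (rule sums_group[OF f]) simp
  moreover have "sum ?f {n * 2..<n * 2 + 2} = 1 / (real (2*n+1))\<^sup>2 + (1/4) * ?f n" for n
  proof -
    have "{n * 2..<n * 2 + 2} = {2*n, 2*n+1}" by auto
    moreover have "(real (2*n+1) + 1)\<^sup>2 = 4 * (real n + 1)\<^sup>2" by (simp add: power2_eq_square algebra_simps)
    ultimately show ?thesis by simp
  qed
  ultimately have "(\<lambda>n. 1 / (real (2*n+1))\<^sup>2 + (1/4) * ?f n) sums (pi\<^sup>2 / 6)" by simp
  from sums_diff[OF this sums_mult[OF f, of "1/4"]]
  show ?thesis by simp
qed

text \<open>The last term pays for the part of the infinite geometric series beyond the last node.\<close>

lemma geometric_nodes_bound:
  fixes K h u m :: real
  assumes "1 \<le> K" "0 < h" "1 / h \<le> m"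
  shows "exp (- K * u) / (1 - exp (- K * h))
    \<le> (\<Sum>j\<le>r. exp (- K * (u + real j * h))) + m * exp (- K * (u + real r * h))"
proof -
  let ?q = "exp (- K * h)"
  have q: "0 < ?q" "?q < 1" using assms by (auto simp: mult_pos_pos)
  have "(\<Sum>j\<le>r. exp (- K * (u + real j * h))) = exp (- K * u) * (\<Sum>j\<le>r. ?q ^ j)"
    by (simp add: sum_distrib_left exp_of_nat_mult[symmetric] exp_add[symmetric] algebra_simps)
  also have "\<dots> = exp (- K * u) * ((1 - ?q ^ Suc r) / (1 - ?q))"
  proof -
    have "?q \<noteq> 1" using q by linarith
    then show ?thesis by (simp only: sum_gp0 if_False)
  qed
  finally have s: "(\<Sum>j\<le>r. exp (- K * (u + real j * h))) = exp (- K * u) / (1 - ?q) - exp (- K * u) * ?q ^ r * (?q / (1 - ?q))"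
    by (simp add: field_simps diff_divide_distrib)
  have e: "exp (- K * u) * ?q ^ r = exp (- K * (u + real r * h))"
    by (simp add: exp_of_nat_mult[symmetric] exp_add[symmetric] algebra_simps)
  have kh: "0 < K * h" "K \<noteq> 0" "h \<noteq> 0" using assms by (auto intro: mult_pos_pos)
  \<comment> \<open>Because \<open>1 \<le> K\<close>, the missing tail is at most 1 / (K h) <= 1 / h
    <= m; a single multiplicity \<open>m\<close> thus serves all exponents K = 2 i + 1.\<close>
  have "?q / (1 - ?q) = 1 / (exp (K * h) - 1)"
    using q kh by (simp add: exp_minus divide_simps)
  also have "\<dots> \<le> 1 / (K * h)"
  proof (rule divide_left_mono)
    have "K * h \<noteq> 0" "1 + K * h \<le> exp (K * h)" using kh exp_ge_add_one_self[of "K*h"] by auto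
    then show "K * h \<le> exp (K * h) - 1" by linarith
    with kh(1) have "0 < exp (K * h) - 1" by linarith
    with kh(1) show "0 < (exp (K * h) - 1) * (K * h)" by (rule mult_pos_pos[rotated])
  qed simp
  also have "\<dots> \<le> 1 / h" using assms by (intro divide_left_mono) auto
  also have "\<dots> \<le> m" by fact
  finally have "exp (- K * (u + real r * h)) * (?q / (1 - ?q)) \<le> exp (- K * (u + real r * h)) * m"
    by (intro mult_left_mono) auto
  then show ?thesis unfolding s e by (simp add: algebra_simps)
qed

text \<open>Compares 1 / sinh with its pole at 0. The pole produces the main term of the rate, and
  the error 2 x / (1 + x^2) is chosen because its weighted sum is controlled by arctan. With
  denominators cleared, the claim follows by differentiating twice.\<close>

lemma sinh_bound:
  fixes x :: real
  assumes "0 < x"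
  shows "1 / x - 2 * x / (1 + x\<^sup>2) \<le> 1 / sinh x"
proof -
  have c: "(1 - t\<^sup>2) * cosh t \<le> 1" if "0 \<le> t" for t :: real
  proof -
    have "(1 - t\<^sup>2) * cosh t \<le> (1 - 0\<^sup>2) * cosh 0"
    proof (rule DERIV_nonpos_imp_nonincreasing[OF that])
      fix u :: real assume u: "0 \<le> u"
      have "u * cosh u - sinh u \<ge> 0 * cosh 0 - sinh 0"
        by (rule DERIV_nonneg_imp_nondecreasing[OF u]) (auto intro!: exI derivative_eq_intros)
      moreover have "u * cosh u \<ge> 0" "u\<^sup>2 * sinh u \<ge> 0" using u by auto
      ultimately have "-2 * u * cosh u + (1 - u\<^sup>2) * sinh u \<le> 0" by (simp add: algebra_simps)
      moreover have "((\<lambda>t. (1 - t\<^sup>2) * cosh t) has_real_derivative -2 * u * cosh u + (1 - u\<^sup>2) * sinh u) (at u)"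
        by (auto intro!: derivative_eq_intros)
      ultimately show "\<exists>y. ((\<lambda>t. (1 - t\<^sup>2) * cosh t) has_real_derivative y) (at u) \<and> y \<le> 0" by blast
    qed
    then show ?thesis by simp
  qed
  have "0 * (1 + 0\<^sup>2) - (1 - 0\<^sup>2) * sinh 0 \<le> x * (1 + x\<^sup>2) - (1 - x\<^sup>2) * sinh x"
  proof (rule DERIV_nonneg_imp_nondecreasing[of 0 x "\<lambda>x. x * (1 + x\<^sup>2) - (1 - x\<^sup>2) * sinh x"])
    fix u :: real assume u: "0 \<le> u"
    have "((\<lambda>x. x * (1 + x\<^sup>2) - (1 - x\<^sup>2) * sinh x) has_real_derivative 1 + 3 * u\<^sup>2 + 2 * (u * sinh u) - (1 - u\<^sup>2) * cosh u) (at u)"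
      by (auto intro!: derivative_eq_intros simp: power2_eq_square algebra_simps)
    moreover have "1 + 3 * u\<^sup>2 + 2 * (u * sinh u) - (1 - u\<^sup>2) * cosh u \<ge> 0"
      using c[OF u] mult_nonneg_nonneg[OF u, of "sinh u"] u zero_le_power2[of u]
      by (smt (verit) sinh_real_nonneg_iff)
    ultimately show "\<exists>y. ((\<lambda>x. x * (1 + x\<^sup>2) - (1 - x\<^sup>2) * sinh x) has_real_derivative y) (at u) \<and> 0 \<le> y"
      by blast
  qed (use assms in simp)
  then have "(1 - x\<^sup>2) * sinh x \<le> x * (1 + x\<^sup>2)" by simp
  moreover have "sinh x > 0" using assms by simp
  moreover have p: "1 + x\<^sup>2 > 0" by (simp add: add_pos_nonneg)
  moreover have "x * (1 + x\<^sup>2) > 0" using assms p by simp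
  ultimately have "(1 - x\<^sup>2) / (x * (1 + x\<^sup>2)) \<le> 1 / sinh x"
    by (metis divide_le_eq mult.commute mult_1 pos_le_divide_eq times_divide_eq_left)
  moreover have "1 / x - 2 * x / (1 + x\<^sup>2) = (1 - x\<^sup>2) / (x * (1 + x\<^sup>2))"
    using assms p by (simp add: field_simps power2_eq_square)
  ultimately show ?thesis by simp
qed

text \<open>On the left half of each cell of length \<open>h\<close> the integrand \<open>1 / (1 + t\<^sup>2)\<close> exceeds its value at
  the midpoint, so the sum is at most twice the integral.\<close>

lemma sum_arctan_bound:
  fixes h :: real
  assumes "0 < h"
  shows "(\<Sum>i<I. h / (1 + (real (2*i+1) * h / 2)\<^sup>2)) \<le> pi"
proof -
  have "h / (1 + (real (2*i+1) * h / 2)\<^sup>2) \<le> 2 * (arctan (real (Suc i) * h) - arctan (real i * h))" for i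
  proof -
    let ?a = "real i * h" and ?b = "real (2*i+1) * h / 2"
    have ab: "?a < ?b" using assms by (simp add: field_simps)
    obtain z where z: "?a < z" "z < ?b" "arctan ?b - arctan ?a = (?b - ?a) * inverse (1 + z\<^sup>2)"
      using MVT2[OF ab, of arctan "\<lambda>z. inverse (1 + z\<^sup>2)"] by (auto intro: DERIV_arctan)
    have "0 \<le> ?a" using assms by simp
    then have "z\<^sup>2 \<le> ?b\<^sup>2" using z by (intro power_mono) auto
    then have "1 / (1 + ?b\<^sup>2) \<le> 1 / (1 + z\<^sup>2)"
      by (intro divide_left_mono mult_pos_pos) (auto simp: add_pos_nonneg)
    then have "(h/2) * (1 / (1 + ?b\<^sup>2)) \<le> (h/2) * (1 / (1 + z\<^sup>2))"
      using assms by (intro mult_left_mono) auto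
    also have "\<dots> = arctan ?b - arctan ?a" using z(3) by (simp add: field_simps)
    also have "\<dots> \<le> arctan (real (Suc i) * h) - arctan ?a"
    proof -
      have "?b \<le> real (Suc i) * h" using assms by (simp add: field_simps)
      then show ?thesis by (simp only: arctan_le_iff diff_right_mono)
    qed
    finally have "(h/2) * (1 / (1 + ?b\<^sup>2)) \<le> arctan (real (Suc i) * h) - arctan ?a" .
    moreover have "h / Y = 2 * ((h/2) * (1 / Y))" for Y by simp
    ultimately show ?thesis by (metis mult_le_cancel_left_pos zero_less_numeral)
  qed
  then have "(\<Sum>i<I. h / (1 + (real (2*i+1) * h / 2)\<^sup>2)) \<le> (\<Sum>i<I. 2 * (arctan (real (Suc i) * h) - arctan (real i * h)))"
    by (intro sum_mono) auto
  also have "\<dots> = 2 * (arctan (real I * h) - arctan 0)"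
    unfolding sum_distrib_left[symmetric] sum_lessThan_telescope[of "\<lambda>i. arctan (real i * h)" I] by simp
  also have "\<dots> \<le> pi" using arctan_ubound[of "real I * h"] by simp
  finally show ?thesis .
qed

text \<open>At x = (2 i + 1) h / 2 with weight 1 / (2 i + 1), the pole term of
  \<open>sinh_bound\<close> becomes a sum over odd squares, while the error terms add up to at most
  pi whatever \<open>h\<close> and \<open>I\<close> are.\<close>

lemma sum_inverse_sinh_bound:
  fixes h :: real
  assumes "0 < h"
  shows "2 / h * (\<Sum>i<I. 1 / (real (2*i+1))\<^sup>2) - pi \<le> (\<Sum>i<I. 1 / (real (2*i+1) * sinh (real (2*i+1) * h / 2)))"
proof -
  have "2 / h * (1 / (real (2*i+1))\<^sup>2) - h / (1 + (real (2*i+1) * h / 2)\<^sup>2) \<le> 1 / (real (2*i+1) * sinh (real (2*i+1) * h / 2))" for i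
  proof -
    let ?k = "real (2*i+1)"
    have k: "?k > 0" by simp
    let ?x = "?k * h / 2"
    have "?x > 0" using assms k by simp
    from sinh_bound[OF this] have "(1 / ?k) * (1 / ?x - 2 * ?x / (1 + ?x\<^sup>2)) \<le> (1 / ?k) * (1 / sinh ?x)"
      using k by (intro mult_left_mono) auto
    also have "(1 / ?k) * (1 / ?x - 2 * ?x / (1 + ?x\<^sup>2)) = 2 / h * (1 / ?k\<^sup>2) - h / (1 + ?x\<^sup>2)"
      using k assms by (simp add: power2_eq_square field_simps del: of_nat_add of_nat_mult of_nat_Suc)
    finally show ?thesis by simp
  qed
  then have "(\<Sum>i<I. 2 / h * (1 / (real (2*i+1))\<^sup>2) - h / (1 + (real (2*i+1) * h / 2)\<^sup>2)) \<le> (\<Sum>i<I. 1 / (real (2*i+1) * sinh (real (2*i+1) * h / 2)))"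
    by (intro sum_mono) auto
  then show ?thesis using sum_arctan_bound[OF assms, of I]
    by (simp add: sum_subtractf sum_distrib_left)
qed

text \<open>If the nodes continued to infinity on both sides, the sum would be (exp (-K u) + exp (-K
  v)) / (1 - exp (-K h)), where u + v = h are the distances from \<open>s\<close> to the two
  neighbouring nodes. By the arithmetic-geometric mean inequality it is least at the midpoint of a
  cell, with value 1 / sinh (K h / 2).\<close>

lemma two_sided_nodes_bound:
  fixes K h S s m :: real
  assumes "1 \<le> K" "0 < h" "1 / h \<le> m" "0 < n" "real n * h = 2 * S" "-S \<le> s" "s \<le> S"
  shows "1 / sinh (K * h / 2) \<le> (\<Sum>j\<le>n. exp (- K * \<bar>s - (real j * h - S)\<bar>))
     + m * exp (- K * (s + S)) + m * exp (- K * (S - s))"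
proof -
  \<comment> \<open>\<open>l\<close> is the cell containing \<open>s\<close>. At s = S the floor
    would give l = n, one too many, so the last cell is taken instead.\<close>
  have "\<exists>l<n. real l * h - S \<le> s \<and> s \<le> real (Suc l) * h - S"
  proof (cases "s = S")
    case True
    with assms show ?thesis by (intro exI[of _ "n-1"]) (auto simp: of_nat_diff algebra_simps)
  next
    case False
    define l where "l = nat \<lfloor>(s + S) / h\<rfloor>"
    have nn: "0 \<le> (s + S) / h" using assms by simp
    then have l: "real l \<le> (s + S) / h" "(s + S) / h < real l + 1"
      unfolding l_def by (simp_all add: floor_correct)
    have "real l * h \<le> s + S" "s + S < (real l + 1) * h" using l assms by (simp_all add: field_simps)
    moreover have "l < n"
    proof -
      have "real l * h < real n * h" using \<open>real l * h \<le> s + S\<close> assms False by linarith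
      then show ?thesis using assms(2) by (simp only: mult_less_cancel_right_pos of_nat_less_iff)
    qed
    ultimately show ?thesis by (intro exI[of _ l]) (auto simp: algebra_simps)
  qed
  then obtain l where l: "l < n" "real l * h - S \<le> s" "s \<le> real (Suc l) * h - S" by blast
  define u where "u = s - (real l * h - S)"
  define v where "v = real (Suc l) * h - S - s"
  have uv: "u + v = h" "0 \<le> u" "0 \<le> v" using l by (auto simp: u_def v_def algebra_simps)
  have left: "(\<Sum>j\<le>l. exp (- K * \<bar>s - (real j * h - S)\<bar>)) = (\<Sum>j\<le>l. exp (- K * (u + real j * h)))"
  proof (rule sum.reindex_bij_witness[of _ "\<lambda>j. l - j" "\<lambda>j. l - j"])
    fix j assume j: "j \<in> {..l}"
    have "real j * h \<le> real l * h" using j assms by (intro mult_right_mono) auto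
    then have "\<bar>s - (real j * h - S)\<bar> = u + real (l - j) * h"
      using uv j by (simp add: u_def of_nat_diff algebra_simps)
    then show "exp (- K * (u + real (l - j) * h)) = exp (- K * \<bar>s - (real j * h - S)\<bar>)" by simp
  qed auto
  have right: "(\<Sum>j\<in>{Suc l..n}. exp (- K * \<bar>s - (real j * h - S)\<bar>)) = (\<Sum>j\<le>n - Suc l. exp (- K * (v + real j * h)))"
  proof (rule sum.reindex_bij_witness[of _ "\<lambda>j. j + Suc l" "\<lambda>j. j - Suc l"])
    fix j assume j: "j \<in> {Suc l..n}"
    then have "real (Suc l) * h \<le> real j * h" using assms by (intro mult_right_mono) auto
    then have "\<bar>s - (real j * h - S)\<bar> = v + real (j - Suc l) * h"
      using uv j by (simp add: v_def of_nat_diff algebra_simps)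
    then show "exp (- K * (v + real (j - Suc l) * h)) = exp (- K * \<bar>s - (real j * h - S)\<bar>)" by simp
  qed (use l in auto)
  have split: "{..n} = {..l} \<union> {Suc l..n}" using l by auto
  have total: "(\<Sum>j\<le>n. exp (- K * \<bar>s - (real j * h - S)\<bar>)) =
     (\<Sum>j\<le>l. exp (- K * (u + real j * h))) + (\<Sum>j\<le>n - Suc l. exp (- K * (v + real j * h)))"
    unfolding left[symmetric] right[symmetric] split by (intro sum.union_disjoint) auto
  have ends: "u + real l * h = s + S" "v + real (n - Suc l) * h = S - s"
    using l assms by (auto simp: u_def v_def of_nat_diff algebra_simps)
  let ?E = "1 - exp (- K * h)"
  have E: "?E > 0" using assms by (simp add: mult_pos_pos)
  have "1 / sinh (K * h / 2) = 2 * exp (- K * h / 2) / ?E"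
  proof -
    have "sinh (K * h / 2) = ?E / (2 * exp (- K * h / 2))"
      by (simp add: sinh_field_def divide_simps exp_minus exp_add[symmetric] field_simps)
    then show ?thesis by simp
  qed
  also have "\<dots> \<le> (exp (- K * u) + exp (- K * v)) / ?E"
  proof (intro divide_right_mono)
    have "exp (- K * u) = exp (- K * u / 2) ^ 2" "exp (- K * v) = exp (- K * v / 2) ^ 2"
      by (simp_all add: exp_double[symmetric])
    moreover have "exp (- K * h / 2) = exp (- K * u / 2) * exp (- K * v / 2)"
      unfolding exp_add[symmetric] uv(1)[symmetric] by (simp add: field_simps)
    ultimately show "2 * exp (- K * h / 2) \<le> exp (- K * u) + exp (- K * v)"
      using sum_squares_bound[of "exp (- K * u / 2)" "exp (- K * v / 2)"] by simp
  qed (use E in auto)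
  also have "\<dots> = exp (- K * u) / ?E + exp (- K * v) / ?E" by (simp add: add_divide_distrib)
  also have "\<dots> \<le> ((\<Sum>j\<le>l. exp (- K * (u + real j * h))) + m * exp (- K * (s + S)))
     + ((\<Sum>j\<le>n - Suc l. exp (- K * (v + real j * h))) + m * exp (- K * (S - s)))"
    using geometric_nodes_bound[OF assms(1-3), of u l] geometric_nodes_bound[OF assms(1-3), of v "n - Suc l"]
    unfolding ends by (rule add_mono)
  finally show ?thesis unfolding total by simp
qed

text \<open>The left side is tanh (|s - t| / 2), the Cayley transform of z = exp (- |s - t|), to
  which the partial artanh series applies.\<close>

lemma cayley_exp_bound:
  fixes s t :: real
  shows "\<bar>(exp s - exp t) / (exp s + exp t)\<bar> \<le> exp (- 2 * (\<Sum>i<I. exp (- real (2*i+1) * \<bar>s - t\<bar>) / real (2*i+1)))"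
proof -
  have "\<bar>(exp s - exp t) / (exp s + exp t)\<bar> = (1 - exp (- \<bar>s - t\<bar>)) / (1 + exp (- \<bar>s - t\<bar>))"
  proof -
    have *: "\<bar>(exp a - exp b) / (exp a + exp b)\<bar> = (1 - exp (- (a - b))) / (1 + exp (- (a - b)))" if "b \<le> a" for a b :: real
    proof -
      have e: "exp (- (a - b)) = exp b / exp a" by (simp add: exp_diff)
      have "(1 - exp b / exp a) / (1 + exp b / exp a) = (exp a - exp b) / (exp a + exp b)"
        using mult_divide_mult_cancel_left[of "exp a" "1 - exp b / exp a" "1 + exp b / exp a"]
        by (simp add: right_diff_distrib distrib_left)
      then show ?thesis using that unfolding e by (simp add: add_pos_pos abs_of_nonneg)
    qed
    show ?thesis using *[of t s] *[of s t]
      by (cases "t \<le> s") (auto simp: abs_minus_commute add.commute)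
  qed
  also have "\<dots> \<le> exp (- 2 * (\<Sum>i<I. exp (- \<bar>s - t\<bar>) ^ (2*i+1) / real (2*i+1)))"
    by (rule cayley_le_exp_artanh_partial_sum) auto
  also have "(\<Sum>i<I. exp (- \<bar>s - t\<bar>) ^ (2*i+1) / real (2*i+1)) = (\<Sum>i<I. exp (- real (2*i+1) * \<bar>s - t\<bar>) / real (2*i+1))"
    by (intro sum.cong refl arg_cong2[of _ _ _ _ "(/)"]) (simp add: exp_of_nat_mult[symmetric] left_diff_distrib distrib_right del: power_Suc)
  finally show ?thesis .
qed

lemma prod_list_le_exp_sum_list:
  fixes f g :: "'a \<Rightarrow> real"
  assumes "\<And>x. x \<in> set xs \<Longrightarrow> 0 \<le> f x \<and> f x \<le> exp (g x)"
  shows "0 \<le> prod_list (map f xs) \<and> prod_list (map f xs) \<le> exp (sum_list (map g xs))"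
  using assms
proof (induction xs)
  case (Cons x xs)
  then have "0 \<le> prod_list (map f xs) \<and> prod_list (map f xs) \<le> exp (sum_list (map g xs))" "0 \<le> f x \<and> f x \<le> exp (g x)"
    by auto
  then show ?case by (auto simp: exp_add intro!: mult_mono)
qed auto

text \<open>In the variable \<open>s = ln w\<close> each factor is \<open>tanh (\<bar>s - t\<bar> / 2)\<close>, and \<open>- ln tanh (u / 2)\<close> is a
  positive combination of the exponentials \<open>exp (- (2 i + 1) u)\<close>. Hence nodes \<open>t\<close> equally spaced over
  \<open>[-S, S]\<close> already give the asymptotically optimal rate, once \<open>m\<close> extra copies of each endpoint make
  up for the missing nodes outside the interval.\<close>

lemma zolotarev_nodes:
  fixes S :: real
  assumes "0 < S" "0 < n" "real n \<le> 2 * S * real m"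
  shows "\<exists>ps. length ps = n + 1 + 2 * m \<and> (\<forall>p\<in>set ps. 0 < p) \<and>
    (\<forall>w. exp (- S) \<le> w \<and> w \<le> exp S \<longrightarrow>
      prod_list (map (\<lambda>p. \<bar>(w - p) / (w + p)\<bar>) ps) \<le> exp (2 * pi - pi\<^sup>2 * real n / (4 * S)))"
proof -
  define h where "h = 2 * S / real n"
  have h: "0 < h" "real n * h = 2 * S" "1 / h \<le> real m" using assms by (auto simp: h_def field_simps)
  define ts where "ts = map (\<lambda>j. real j * h - S) [0..<n+1] @ replicate m (-S) @ replicate m S"
  have bound: "prod_list (map (\<lambda>p. \<bar>(w - p) / (w + p)\<bar>) (map exp ts)) \<le> exp (2 * pi - pi\<^sup>2 * real n / (4 * S))"
    if w: "exp (- S) \<le> w" "w \<le> exp S" for w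
  proof -
    define s where "s = ln w"
    have "0 < w" using w(1) exp_gt_zero[of "-S"] by linarith
    then have ws: "w = exp s" and s: "-S \<le> s" "s \<le> S"
      using w by (auto simp: s_def ln_ge_iff ln_le_cancel_iff[of w "exp S", simplified])
    \<comment> \<open>The bound is proved for every truncation \<open>I\<close> of the artanh
      series; only afterwards does \<open>I\<close> tend to infinity, where the odd squares supply
      pi^2/8 and 4 / h * pi^2/8 is the stated rate.\<close>
    have main: "prod_list (map (\<lambda>p. \<bar>(w - p) / (w + p)\<bar>) (map exp ts))
      \<le> exp (2 * pi - 4 / h * (\<Sum>i<I. 1 / (real (2*i+1))\<^sup>2))" for I
    proof -
      let ?g = "\<lambda>t. - 2 * (\<Sum>i<I. exp (- real (2*i+1) * \<bar>s - t\<bar>) / real (2*i+1))"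
      have "prod_list (map (\<lambda>p. \<bar>(w - p) / (w + p)\<bar>) (map exp ts)) \<le> exp (sum_list (map ?g ts))"
        using prod_list_le_exp_sum_list[of ts "\<lambda>t. \<bar>(w - exp t) / (w + exp t)\<bar>" ?g] cayley_exp_bound[of s _ I]
        unfolding ws by (simp add: o_def)
      also have "sum_list (map ?g ts) = - 2 * (\<Sum>i<I. ((\<Sum>j\<le>n. exp (- real (2*i+1) * \<bar>s - (real j * h - S)\<bar>))
         + real m * exp (- real (2*i+1) * (s + S)) + real m * exp (- real (2*i+1) * (S - s))) / real (2*i+1))"
      proof -
        have "sum_list (map ?g ts) = (\<Sum>j\<in>{0..<n+1}. ?g (real j * h - S)) + real m * ?g (-S) + real m * ?g S"
          unfolding ts_def map_append sum_list.append map_replicate sum_list_replicate map_map o_def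
          by (subst interv_sum_list_conv_sum_set_nat) simp
        also have "(\<Sum>j\<in>{0..<n+1}. ?g (real j * h - S)) = (\<Sum>j\<le>n. ?g (real j * h - S))"
          by (intro sum.cong) auto
        also have "\<dots> = -2 * (\<Sum>i<I. \<Sum>j\<le>n. exp (- real (2*i+1) * \<bar>s - (real j * h - S)\<bar>) / real (2*i+1))"
          unfolding sum_distrib_left[symmetric] by (subst sum.swap) simp
        also have "?g (-S) = -2 * (\<Sum>i<I. exp (- real (2*i+1) * (s + S)) / real (2*i+1))"
          using s by simp
        also have "?g S = -2 * (\<Sum>i<I. exp (- real (2*i+1) * (S - s)) / real (2*i+1))"
          using s by simp
        finally show ?thesis
          by (simp add: sum.distrib add_divide_distrib sum_divide_distrib sum_distrib_left algebra_simps)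
      qed
      also have "\<dots> \<le> - 2 * (\<Sum>i<I. 1 / (real (2*i+1) * sinh (real (2*i+1) * h / 2)))"
      proof -
        have "1 / (real (2*i+1) * sinh (real (2*i+1) * h / 2)) \<le>
           ((\<Sum>j\<le>n. exp (- real (2*i+1) * \<bar>s - (real j * h - S)\<bar>))
         + real m * exp (- real (2*i+1) * (s + S)) + real m * exp (- real (2*i+1) * (S - s))) / real (2*i+1)" for i
          using divide_right_mono[OF two_sided_nodes_bound[of "real (2*i+1)" h "real m" n S s], of "real (2*i+1)"]
             h assms s by (simp add: mult.commute)
        then show ?thesis by (simp add: sum_mono)
      qed
      also have "\<dots> \<le> -2 * (2 / h * (\<Sum>i<I. 1 / (real (2*i+1))\<^sup>2) - pi)"
        using sum_inverse_sinh_bound[OF h(1), of I] by simp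
      finally show ?thesis by (simp add: algebra_simps)
    qed
    have "(\<lambda>I. \<Sum>i<I. 1 / (real (2*i+1))\<^sup>2) \<longlonglongrightarrow> pi\<^sup>2 / 8"
      using sum_inverse_odd_squares unfolding sums_def .
    then have "(\<lambda>I. exp (2 * pi - 4 / h * (\<Sum>i<I. 1 / (real (2*i+1))\<^sup>2))) \<longlonglongrightarrow> exp (2 * pi - 4 / h * (pi\<^sup>2 / 8))"
      by (intro tendsto_intros)
    from LIMSEQ_le_const[OF this] main
    have "prod_list (map (\<lambda>p. \<bar>(w - p) / (w + p)\<bar>) (map exp ts)) \<le> exp (2 * pi - 4 / h * (pi\<^sup>2 / 8))" by blast
    also have "4 / h * (pi\<^sup>2 / 8) = pi\<^sup>2 * real n / (4 * S)" using assms by (simp add: h_def)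
    finally show ?thesis .
  qed
  then show ?thesis
    by (intro exI[of _ "map exp ts"]) (auto simp: ts_def)
qed

section \<open>Polynomials built from the nodes\<close>

lemma poly_prod_list: "poly (prod_list (map f ps)) x = prod_list (map (\<lambda>p. poly (f p) (x::'a::comm_semiring_1)) ps)"
  by (induction ps) auto

lemma degree_prod_list_linear:
  fixes f :: "'a \<Rightarrow> 'b::comm_semiring_1 poly"
  assumes "\<And>p. degree (f p) \<le> 1"
  shows "degree (prod_list (map f ps)) \<le> length ps"
proof (induction ps)
  case (Cons p ps)
  have "degree (f p * prod_list (map f ps)) \<le> degree (f p) + degree (prod_list (map f ps))"
    by (rule degree_mult_le)
  also have "\<dots> \<le> 1 + length ps" using assms[of p] Cons by linarith
  finally show ?case by simp
qed auto

lemma abs_prod_list_divide: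
  fixes a b :: "'a \<Rightarrow> real"
  shows "\<bar>prod_list (map a ps) / prod_list (map b ps)\<bar> = prod_list (map (\<lambda>p. \<bar>a p / b p\<bar>) ps)"
proof (induction ps)
  case (Cons p ps)
  show ?case using Cons by (simp add: abs_mult times_divide_times_eq[symmetric] del: times_divide_eq_left times_divide_eq_right times_divide_times_eq)
qed auto

text \<open>The substitution \<open>w = (x - 1) / (c - 1 - x)\<close> maps \<open>[2, c - 2]\<close> into \<open>[1 / (c - 1), c - 1]\<close> and the
  complement of \<open>(0, c)\<close> into the negative of that interval.\<close>

lemma separating_polynomials:
  fixes c :: real
  assumes "4 \<le> c" "0 < n" "real n \<le> 2 * ln (c - 1) * real m"
  defines "\<epsilon> \<equiv> exp (2 * pi - pi\<^sup>2 * real n / (4 * ln (c - 1)))"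
  shows "\<exists>N D :: real poly. degree N \<le> n + 1 + 2 * m \<and> degree D \<le> n + 1 + 2 * m \<and>
    (\<forall>x. 2 \<le> x \<and> x \<le> c - 2 \<longrightarrow> poly D x \<noteq> 0 \<and> \<bar>poly N x / poly D x\<bar> \<le> \<epsilon>) \<and>
    (\<forall>y. y \<le> 0 \<or> c \<le> y \<longrightarrow> poly N y \<noteq> 0 \<and> \<bar>poly D y / poly N y\<bar> \<le> \<epsilon>)"
proof -
  have S: "0 < ln (c - 1)" using assms by simp
  have eS: "exp (ln (c - 1)) = c - 1" "exp (- ln (c - 1)) = 1 / (c - 1)" using assms by (auto simp: exp_minus field_simps)
  obtain ps where ps: "length ps = n + 1 + 2 * m" "\<And>p. p \<in> set ps \<Longrightarrow> 0 < p"
    "\<And>w. 1 / (c - 1) \<le> w \<Longrightarrow> w \<le> c - 1 \<Longrightarrow> prod_list (map (\<lambda>p. \<bar>(w - p) / (w + p)\<bar>) ps) \<le> \<epsilon>"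
    using zolotarev_nodes[OF S assms(2,3)] unfolding eS \<epsilon>_def by blast
  define num where "num = (\<lambda>p x. (x - 1) - p * (c - 1 - x))"
  define den where "den = (\<lambda>p x. (x - 1) + p * (c - 1 - x))"
  define N where "N = prod_list (map (\<lambda>p. [: - 1 - p * (c - 1), 1 + p :]) ps)"
  define D where "D = prod_list (map (\<lambda>p. [: p * (c - 1) - 1, 1 - p :]) ps)"
  have N: "poly N x = prod_list (map (\<lambda>p. num p x) ps)" for x
    unfolding N_def poly_prod_list num_def by (simp add: algebra_simps)
  have D: "poly D x = prod_list (map (\<lambda>p. den p x) ps)" for x
    unfolding D_def poly_prod_list den_def by (simp add: algebra_simps)
  have "degree N \<le> n + 1 + 2 * m" "degree D \<le> n + 1 + 2 * m"
    unfolding N_def D_def ps(1)[symmetric] by (rule degree_prod_list_linear; simp)+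
  moreover have "poly D x \<noteq> 0 \<and> \<bar>poly N x / poly D x\<bar> \<le> \<epsilon>" if x: "2 \<le> x" "x \<le> c - 2" for x
  proof -
    let ?w = "(x - 1) / (c - 1 - x)"
    have d: "0 < c - 1 - x" using x by simp
    have "(c - 1 - x) \<le> (x - 1) * (c - 1)" using mult_mono[of 1 "x-1" "c-1-x" "c-1"] x by simp
    then have w1: "1 / (c - 1) \<le> ?w" using d assms(1) by (simp add: divide_simps)
    have "(x - 1) \<le> (c - 1) * (c - 1 - x)" using mult_mono[of "x-1" "c-1" 1 "c-1-x"] x by simp
    then have w2: "?w \<le> c - 1" using d by (simp add: divide_simps)
    have dp: "0 < den p x" if "0 < p" for p using mult_pos_pos[OF that d] x by (simp add: den_def)
    have nz: "poly D x \<noteq> 0"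
      unfolding D using ps(2) dp by (force simp: prod_list_zero_iff)
    have "num p x / den p x = (?w - p) / (?w + p)" if "p \<in> set ps" for p
    proof -
      have "num p x = (?w - p) * (c - 1 - x)" "den p x = (?w + p) * (c - 1 - x)"
        using d by (auto simp: num_def den_def distrib_right[of ?w] left_diff_distrib[of ?w])
      then show ?thesis using d by simp
    qed
    then have "map (\<lambda>p. \<bar>num p x / den p x\<bar>) ps = map (\<lambda>p. \<bar>(?w - p) / (?w + p)\<bar>) ps"
      by (intro map_cong refl) metis
    then have "\<bar>poly N x / poly D x\<bar> = prod_list (map (\<lambda>p. \<bar>(?w - p) / (?w + p)\<bar>) ps)"
      unfolding N D abs_prod_list_divide by metis
    with nz ps(3)[OF w1 w2] show ?thesis by simp
  qed
  moreover have "poly N y \<noteq> 0 \<and> \<bar>poly D y / poly N y\<bar> \<le> \<epsilon>" if y: "y \<le> 0 \<or> c \<le> y" for y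
  proof -
    \<comment> \<open>This is the negative of the substitution used on [2, c - 2]. Replacing w by -w
      exchanges the factors w - p and w + p up to sign, so the same nodes that make N/D small inside
      make D/N small outside.\<close>
    let ?w = "(y - 1) / (y - (c - 1))"
    have d: "y - (c - 1) \<noteq> 0" using y assms(1) by auto
    have w: "1 / (c - 1) \<le> ?w \<and> ?w \<le> c - 1"
    proof (cases "y \<le> 0")
      case True
      have e: "?w = (1 - y) / (c - 1 - y)" using d by (simp add: divide_simps) (simp add: algebra_simps)
      have dp: "0 < c - 1 - y" using True assms(1) by simp
      have "(c - 1 - y) \<le> (1 - y) * (c - 1)"
        using True assms(1) mult_nonneg_nonneg[of "-y" "c - 2"] by (simp add: algebra_simps)
      moreover have "(1 - y) \<le> (c - 1) * (c - 1 - y)" using mult_mono[of 1 "c-1" "1-y" "c-1-y"] True assms(1) by simp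
      ultimately show ?thesis unfolding e using dp assms(1) by (simp add: divide_simps)
    next
      case False
      with y have y: "c \<le> y" by simp
      then have dp: "0 < y - (c - 1)" by simp
      have "(y - (c - 1)) \<le> (y - 1) * (c - 1)" using mult_mono[of "y-(c-1)" "y-1" 1 "c-1"] y assms(1) by simp
      moreover have "(y - 1) \<le> (c - 1) * (y - (c - 1))"
        using y assms(1) mult_nonneg_nonneg[of "y-c" "c - 2"] by (simp add: algebra_simps)
      ultimately show ?thesis using dp assms(1) by (simp add: divide_simps)
    qed
    have w0: "0 < ?w" using w assms(1) by (smt (verit) zero_less_divide_1_iff)
    have wd: "?w * (y - (c - 1)) = y - 1" using d by simp
    have e: "num p y = (?w + p) * (y - (c - 1))" "den p y = (?w - p) * (y - (c - 1))" for p
      using wd by (simp_all only: num_def den_def distrib_right left_diff_distrib) (simp_all add: algebra_simps)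
    have nz: "poly N y \<noteq> 0"
      unfolding N e using ps(2) d w0 by (force simp: prod_list_zero_iff)
    have "den p y / num p y = (?w - p) / (?w + p)" for p
      using d by (simp add: e)
    then have "\<bar>poly D y / poly N y\<bar> = prod_list (map (\<lambda>p. \<bar>(?w - p) / (?w + p)\<bar>) ps)"
      unfolding N D abs_prod_list_divide by presburger
    with nz ps(3) w show ?thesis by simp
  qed
  ultimately show ?thesis by blast
qed

text \<open>As a polynomial in x the left side vanishes at x = y, so x - y divides it and the
  quotient has degree below \<open>k\<close>. The coefficients \<open>q\<close> may depend on y:
  only the powers of x turn into linear conditions.\<close>

lemma bezoutian_quotient:
  fixes N D :: "real poly"
  assumes "degree N \<le> k" "degree D \<le> k" "0 < k"
  shows "\<exists>q. \<forall>x. poly N y * poly D x - poly D y * poly N x = (x - y) * (\<Sum>i<k. q i * x ^ i)"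
proof -
  let ?R = "smult (poly N y) D - smult (poly D y) N"
  have "poly ?R y = 0" by simp
  then obtain Q where Q: "?R = [:- y, 1:] * Q" unfolding poly_eq_0_iff_dvd by blast
  have "degree ?R \<le> k" using assms by (intro degree_diff_le) (meson degree_smult_le order_trans)+
  then have deg: "Q = 0 \<or> degree Q < k" unfolding Q
    by (cases "Q = 0") (auto simp del: mult_pCons_left simp: degree_mult_eq)
  have "poly Q x = (\<Sum>i<k. coeff Q i * x ^ i)" for x
  proof (cases "Q = 0")
    case False
    then have "degree Q < k" using deg by simp
    then have "(\<Sum>i\<le>degree Q. coeff Q i * x ^ i) = (\<Sum>i<k. coeff Q i * x ^ i)"
      by (intro sum.mono_neutral_left) (auto simp: coeff_eq_0)
    then show ?thesis by (simp add: poly_altdef)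
  qed auto
  moreover have "poly N y * poly D x - poly D y * poly N x = (x - y) * poly Q x" for x
    using arg_cong[OF Q, of "\<lambda>p. poly p x"] by (simp add: algebra_simps)
  ultimately show ?thesis by metis
qed

section \<open>The sinc kernel\<close>

text \<open>The function \<open>sinc\<close> with its argument scaled by pi.
  \<open>sine_kernel\<close> is its value at the difference of the arguments, now available as a
  convolution kernel on the whole line.\<close>

definition psinc :: "real \<Rightarrow> real"
  where "psinc t = (if t = 0 then 1 else sin (pi * t) / (pi * t))"

lemma psinc_sin: "pi * t * psinc t = sin (pi * t)"
  by (simp add: psinc_def)

lemma psinc_minus [simp]: "psinc (- t) = psinc t"
  by (simp add: psinc_def)

lemma isCont_psinc: "isCont psinc t"
proof -
  have "psinc = (\<lambda>t. sinc (pi * t))" by (auto simp: psinc_def fun_eq_iff)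
  then show ?thesis
    using isCont_o2[of t "\<lambda>t. pi * t" sinc] isCont_sinc by auto
qed

lemma continuous_on_psinc [continuous_intros]:
  "continuous_on S f \<Longrightarrow> continuous_on S (\<lambda>x. psinc (f x))"
  using continuous_on_compose[of S f psinc] isCont_psinc
  by (auto simp: o_def continuous_at_imp_continuous_on)

lemma borel_measurable_psinc [measurable]: "psinc \<in> borel_measurable borel"
  by (intro borel_measurable_continuous_onI continuous_intros)

lemma abs_psinc_le_1: "\<bar>psinc t\<bar> \<le> 1"
proof (cases "t = 0")
  case False
  then have "\<bar>sin (pi * t)\<bar> \<le> 1 * \<bar>pi * t\<bar>" using abs_sin_x_le_abs_x[of "pi * t"] by simp
  with False show ?thesis by (simp add: psinc_def abs_div divide_le_eq_1)
qed (simp add: psinc_def)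

text \<open>The kernel is square integrable over the line but not integrable, so the domination
  arguments on the line work with its square.\<close>

lemma psinc_sq_le: "(psinc t)\<^sup>2 \<le> 2 * inverse (1 + t\<^sup>2)"
proof -
  have a: "(psinc t)\<^sup>2 \<le> 1" using abs_psinc_le_1[of t] by (simp add: abs_square_le_1)
  have "(pi * t * psinc t)\<^sup>2 \<le> 1" unfolding psinc_sin by (simp add: abs_square_le_1)
  moreover have "t\<^sup>2 * (psinc t)\<^sup>2 \<le> pi\<^sup>2 * (t\<^sup>2 * (psinc t)\<^sup>2)"
  proof -
    have "1 \<le> pi\<^sup>2" using pi_gt3 by (simp add: one_le_power)
    then show ?thesis using mult_right_mono[of 1 "pi\<^sup>2" "t\<^sup>2 * (psinc t)\<^sup>2"] by simp
  qed
  ultimately have "(1 + t\<^sup>2) * (psinc t)\<^sup>2 \<le> 2" using a by (simp add: power_mult_distrib algebra_simps)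
  moreover have "0 < 1 + t\<^sup>2" by (simp add: add_pos_nonneg)
  ultimately show ?thesis by (simp add: field_simps)
qed

lemma integrable_inverse_1_plus_square_lborel: "integrable lborel (\<lambda>x::real. inverse (1 + x\<^sup>2))"
  using integrable_inverse_1_plus_square by (simp add: set_integrable_def einterval_def)

lemma integrable_psinc_sq: "integrable lborel (\<lambda>t. (psinc t)\<^sup>2)"
  by (rule Bochner_Integration.integrable_bound[OF integrable_mult_right[OF integrable_inverse_1_plus_square_lborel, of 2]])
    (use psinc_sq_le in \<open>auto simp: abs_of_nonneg\<close>)

lemma integrable_psinc_sq_shift: "integrable lborel (\<lambda>y. (psinc (x - y))\<^sup>2)"
  using lborel_integrable_real_affine[OF integrable_psinc_sq, of "-1" x] by simp

lemma integral_psinc_sq_shift: "(\<integral>y. (psinc (x - y))\<^sup>2 \<partial>lborel) = (\<integral>y. (psinc y)\<^sup>2 \<partial>lborel)"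
  using lborel_integral_real_affine[of "-1" "\<lambda>t. (psinc t)\<^sup>2" x] by simp

lemma abs_mult_le_squares: "\<bar>a * b\<bar> \<le> a\<^sup>2 + (b::real)\<^sup>2"
proof -
  have "2 * (\<bar>a\<bar> * \<bar>b\<bar>) \<le> a\<^sup>2 + b\<^sup>2" using sum_squares_bound[of "\<bar>a\<bar>" "\<bar>b\<bar>"] by simp
  moreover have "0 \<le> \<bar>a\<bar> * \<bar>b\<bar>" by simp
  ultimately show ?thesis unfolding abs_mult by linarith
qed

lemma integrable_psinc_psinc: "integrable lborel (\<lambda>y. psinc (x - y) * psinc (z - y))"
  by (rule Bochner_Integration.integrable_bound[OF Bochner_Integration.integrable_add[OF integrable_psinc_sq_shift[of x] integrable_psinc_sq_shift[of z]]])
    (use abs_mult_le_squares in auto)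

lemma Si_at_bot: "(Si \<longlongrightarrow> - (pi / 2)) at_bot"
proof -
  have "((\<lambda>x. Si (- x)) \<longlongrightarrow> - (pi / 2)) at_top"
    using tendsto_minus[OF Si_at_top]
    by (rule Lim_transform_eventually) (auto intro!: eventually_mono[OF eventually_ge_at_top[of 0]] simp: Si_neg)
  then show ?thesis by (simp add: filterlim_at_bot_mirror)
qed

text \<open>Idempotence of the projection at the level of kernels, by an explicit antiderivative.
  Partial fractions of 1 / (u (a - u)), where \<open>a \<noteq> 0\<close> enters, reduce the
  integral to an antiderivative \<open>W\<close> of sin (pi u) sin (pi (a - u)) / u, taken at u and
  at a - u.\<close>

lemma integral_psinc_psinc_aux:
  assumes a: "a \<noteq> 0"
  shows "(\<integral>u. psinc u * psinc (a - u) \<partial>lborel) = psinc a"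
proof -
  \<comment> \<open>A continuous version of sin^2 (pi t) / t, which is odd; hence its antiderivative
    \<open>V\<close> is even.\<close>
  define v where "v = (\<lambda>t. sin (pi * t) * (pi * psinc t))"
  have v_cont: "isCont v t" for t unfolding v_def by (intro continuous_intros isCont_psinc)
  obtain V where V: "\<And>x. (V has_vector_derivative v x) (at x)"
    using einterval_antiderivative[of "-\<infinity>" "\<infinity>" v] v_cont by auto
  have dV: "(V has_real_derivative v x) (at x)" for x
    using V by (simp add: has_real_derivative_iff_has_vector_derivative)
  have V_even: "V (- x) = V x" for x
  proof -
    have "((\<lambda>x. V x - V (- x)) has_real_derivative 0) (at x)" for x
    proof -
      have "((\<lambda>x. V (- x)) has_real_derivative v (- x) * (-1)) (at x)"
        by (rule DERIV_chain2[OF dV]) (auto intro!: derivative_eq_intros)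
      from DERIV_diff[OF dV this] show ?thesis by (simp add: v_def)
    qed
    from DERIV_isconst_all[OF allI[OF this], of x 0] show ?thesis by simp
  qed
  have v_le: "\<bar>v t\<bar> \<le> 1 / \<bar>t\<bar>" if "t \<noteq> 0" for t
  proof -
    have "v t = sin (pi * t) * sin (pi * t) / t" using that by (simp add: v_def psinc_def)
    moreover have "\<bar>sin (pi * t) * sin (pi * t)\<bar> \<le> 1" unfolding abs_mult by (intro mult_le_one) auto
    ultimately show ?thesis by (simp only: abs_divide) (intro divide_right_mono, simp_all)
  qed
  \<comment> \<open>\<open>V\<close> alone grows logarithmically, but by evenness V (a - u) = V (u -
    a), and over the bounded shift \<open>a\<close> the mean value theorem bounds the change by |a|
    / (|u| - |a|). So \<open>V\<close> drops out at both ends of the line.\<close>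
  have V_diff: "\<bar>V u - V (a - u)\<bar> \<le> \<bar>a\<bar> / (\<bar>u\<bar> - \<bar>a\<bar>)" if u: "\<bar>a\<bar> < \<bar>u\<bar>" for u
  proof -
    have "\<bar>V p - V q\<bar> \<le> \<bar>p - q\<bar> / r" if pq: "p < q" "0 < r" "\<And>t. p < t \<Longrightarrow> t < q \<Longrightarrow> r \<le> \<bar>t\<bar>" for p q r
    proof -
      obtain z where z: "p < z" "z < q" "V q - V p = (q - p) * v z"
        using MVT2[OF pq(1), of V v] dV by auto
      have "r \<le> \<bar>z\<bar>" using that(3) z by blast
      then have "1 / \<bar>z\<bar> \<le> 1 / r" "z \<noteq> 0" using that(2) by (auto intro: frac_le)
      then have "\<bar>v z\<bar> \<le> 1 / r" using v_le[of z] by linarith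
      then have "\<bar>q - p\<bar> * \<bar>v z\<bar> \<le> \<bar>q - p\<bar> * (1 / r)" by (intro mult_left_mono) auto
      then have "\<bar>V q - V p\<bar> \<le> \<bar>q - p\<bar> / r" unfolding z(3) abs_mult by simp
      then show ?thesis by (simp only: abs_minus_commute)
    qed
    note mvt = this
    have "V (a - u) = V (u - a)" using V_even[of "u - a"] by simp
    moreover have "\<bar>V u - V (u - a)\<bar> \<le> \<bar>a\<bar> / (\<bar>u\<bar> - \<bar>a\<bar>)"
    proof (cases "0 < a")
      case True
      then have "\<bar>V (u - a) - V u\<bar> \<le> \<bar>u - a - u\<bar> / (\<bar>u\<bar> - \<bar>a\<bar>)" using u by (intro mvt) linarith+
      then show ?thesis by (simp add: abs_minus_commute[of "V u"])
    next
      case False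
      then have "\<bar>V u - V (u - a)\<bar> \<le> \<bar>u - (u - a)\<bar> / (\<bar>u\<bar> - \<bar>a\<bar>)" using u a by (intro mvt) linarith+
      then show ?thesis by simp
    qed
    ultimately show ?thesis by simp
  qed
  have V_lim: "((\<lambda>u. V u - V (a - u)) \<longlongrightarrow> 0) F" if F: "F \<le> at_infinity" for F
  proof (rule Lim_null_comparison)
    have lim: "filterlim (\<lambda>u::real. \<bar>u\<bar>) at_top F"
      using filterlim_mono[OF filterlim_norm_at_top order_refl F] by (simp add: real_norm_def[abs_def])
    then have "\<forall>\<^sub>F u in F. \<bar>a\<bar> < \<bar>u\<bar>" by (simp add: filterlim_at_top_dense)
    then show "\<forall>\<^sub>F u in F. norm (V u - V (a - u)) \<le> \<bar>a\<bar> / (\<bar>u\<bar> - \<bar>a\<bar>)"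
      by (rule eventually_mono) (use V_diff in simp)
    have "filterlim (\<lambda>u. - \<bar>a\<bar> + \<bar>u\<bar>) at_top F" by (rule filterlim_tendsto_add_at_top[OF tendsto_const lim])
    then show "((\<lambda>u. \<bar>a\<bar> / (\<bar>u\<bar> - \<bar>a\<bar>)) \<longlongrightarrow> 0) F"
      by (intro real_tendsto_divide_at_top[OF tendsto_const]) simp
  qed
  \<comment> \<open>Expanding sin (pi (a - u)) splits the integrand into a multiple of sin (2 pi u)
    / u, integrated by \<open>Si\<close>, and a multiple of \<open>v\<close>.\<close>
  define W where "W = (\<lambda>u. sin (pi * a) / 2 * Si (2 * pi * u) - cos (pi * a) * V u)"
  have dW: "(W has_real_derivative pi * psinc u * sin (pi * (a - u))) (at u)" for u
  proof -
    have "((\<lambda>u. Si (2 * pi * u)) has_real_derivative sinc (2 * pi * u) * (2 * pi)) (at u)"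
      by (rule DERIV_chain2[OF DERIV_Si]) (auto intro!: derivative_eq_intros)
    then have "(W has_real_derivative sin (pi * a) / 2 * (sinc (2 * pi * u) * (2 * pi)) - cos (pi * a) * v u) (at u)"
      unfolding W_def by (intro DERIV_diff DERIV_cmult dV)
    moreover have "sin (pi * a) / 2 * (sinc (2 * pi * u) * (2 * pi)) - cos (pi * a) * v u = pi * psinc u * sin (pi * (a - u))"
    proof (cases "u = 0")
      case False
      have d: "sin (2 * pi * u) = 2 * sin (pi * u) * cos (pi * u)" using sin_double[of "pi * u"] by (simp only: mult.assoc)
      have 1: "sinc (2 * pi * u) * (2 * pi) = 2 * sin (pi * u) * cos (pi * u) / u" using False unfolding d by simp
      have 2: "v u = sin (pi * u) * sin (pi * u) / u" "pi * psinc u = sin (pi * u) / u"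
        using False by (simp_all add: v_def psinc_def)
      have 3: "sin (pi * (a - u)) = sin (pi * a) * cos (pi * u) - cos (pi * a) * sin (pi * u)"
        unfolding right_diff_distrib sin_diff ..
      show ?thesis unfolding 1 2 3 by (simp add: diff_divide_distrib right_diff_distrib mult_ac)
    qed (simp add: v_def psinc_def)
    ultimately show ?thesis by simp
  qed
  \<comment> \<open>The partial fractions recombined: the limits of \<open>H\<close> at the two ends
    are plus and minus half of \<open>psinc a\<close>, and come from the \<open>Si\<close> terms
    only.\<close>
  define H where "H = (\<lambda>u. (W u - W (a - u)) / (pi\<^sup>2 * a))"
  have dH: "(H has_real_derivative psinc u * psinc (a - u)) (at u)" for u
  proof -
    have "((\<lambda>u. W (a - u)) has_real_derivative pi * psinc (a - u) * sin (pi * (a - (a - u))) * (-1)) (at u)"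
      by (rule DERIV_chain2[OF dW]) (auto intro!: derivative_eq_intros)
    then have "(H has_real_derivative (pi * psinc u * sin (pi * (a - u)) - pi * psinc (a - u) * sin (pi * (a - (a - u))) * (-1)) / (pi\<^sup>2 * a)) (at u)"
      unfolding H_def by (intro DERIV_cdivide DERIV_diff dW)
    moreover have "(pi * psinc u * sin (pi * (a - u)) - pi * psinc (a - u) * sin (pi * (a - (a - u))) * (-1)) / (pi\<^sup>2 * a) = psinc u * psinc (a - u)"
    proof -
      have 1: "sin (pi * (a - u)) = pi * (a - u) * psinc (a - u)" "sin (pi * (a - (a - u))) = pi * u * psinc u"
        by (simp_all only: psinc_sin) simp
      have "pi * psinc u * sin (pi * (a - u)) - pi * psinc (a - u) * sin (pi * (a - (a - u))) * (-1) = (pi\<^sup>2 * a) * (psinc u * psinc (a - u))"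
        unfolding 1 by (simp add: algebra_simps power2_eq_square)
      then show ?thesis using a by simp
    qed
    ultimately show ?thesis by simp
  qed
  have Hlim: "(H \<longlongrightarrow> (sin (pi * a) / 2 * (s - - s) - cos (pi * a) * 0) / (pi\<^sup>2 * a)) F"
    if "((\<lambda>u. Si (2 * pi * u)) \<longlongrightarrow> s) F" "((\<lambda>u. Si (2 * pi * (a - u))) \<longlongrightarrow> - s) F"
      "((\<lambda>u. V u - V (a - u)) \<longlongrightarrow> 0) F" for F s
  proof -
    have H: "H = (\<lambda>u. (sin (pi * a) / 2 * (Si (2 * pi * u) - Si (2 * pi * (a - u))) - cos (pi * a) * (V u - V (a - u))) / (pi\<^sup>2 * a))"
      by (simp add: H_def W_def fun_eq_iff algebra_simps)
    show ?thesis unfolding H using a that by (intro tendsto_intros) auto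
  qed
  have top: "(H \<longlongrightarrow> psinc a / 2) at_top"
  proof -
    have "filterlim (\<lambda>u. 2 * pi * u) at_top at_top"
      by (intro filterlim_tendsto_pos_mult_at_top[OF tendsto_const] filterlim_ident) simp
    moreover have "filterlim (\<lambda>u. 2 * pi * (a - u)) at_bot at_top"
    proof -
      have "filterlim (\<lambda>u. 2 * pi * (- a + u)) at_top at_top"
        by (intro filterlim_tendsto_pos_mult_at_top[OF tendsto_const] filterlim_tendsto_add_at_top[OF tendsto_const] filterlim_ident) simp
      then show ?thesis by (simp add: filterlim_uminus_at_top algebra_simps)
    qed
    ultimately have "(H \<longlongrightarrow> (sin (pi * a) / 2 * (pi / 2 - - (pi / 2)) - cos (pi * a) * 0) / (pi\<^sup>2 * a)) at_top"
      using filterlim_compose[OF Si_at_top] filterlim_compose[OF Si_at_bot] V_lim[OF at_top_le_at_infinity] V_lim[OF at_bot_le_at_infinity] by (intro Hlim) auto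
    then show ?thesis using a by (simp add: psinc_def power2_eq_square mult_ac)
  qed
  have bot: "(H \<longlongrightarrow> - psinc a / 2) at_bot"
  proof -
    have "filterlim (\<lambda>u. 2 * pi * u) at_bot at_bot"
      by (intro filterlim_tendsto_pos_mult_at_bot[OF tendsto_const] filterlim_ident) simp
    moreover have "filterlim (\<lambda>u. 2 * pi * (a - u)) at_top at_bot"
    proof -
      have "filterlim (\<lambda>u. 2 * pi * (a + (- u))) at_top at_bot"
        by (intro filterlim_tendsto_pos_mult_at_top[OF tendsto_const] filterlim_tendsto_add_at_top[OF tendsto_const] filterlim_uminus_at_top_at_bot) simp
      then show ?thesis by simp
    qed
    ultimately have "(H \<longlongrightarrow> (sin (pi * a) / 2 * (- (pi / 2) - - (- (pi / 2))) - cos (pi * a) * 0) / (pi\<^sup>2 * a)) at_bot"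
      using filterlim_compose[OF Si_at_top] filterlim_compose[OF Si_at_bot] V_lim[OF at_top_le_at_infinity] V_lim[OF at_bot_le_at_infinity] by (intro Hlim) auto
    then show ?thesis using a by (simp add: psinc_def power2_eq_square mult_ac)
  qed
  have "(LBINT u=-\<infinity>..\<infinity>. psinc u * psinc (a - u)) = psinc a / 2 - (- psinc a / 2)"
  proof (rule interval_integral_FTC_integrable[where F = H])
    show "set_integrable lborel (einterval (- \<infinity>) \<infinity>) (\<lambda>u. psinc u * psinc (a - u))"
      using integrable_psinc_psinc[of 0 a] by (simp add: set_integrable_def einterval_def)
    show "((H \<circ> real_of_ereal) \<longlongrightarrow> - psinc a / 2) (at_right (- \<infinity>))"
      using bot by (simp add: ereal_tendsto_simps)
    show "((H \<circ> real_of_ereal) \<longlongrightarrow> psinc a / 2) (at_left \<infinity>)"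
      using top by (simp add: ereal_tendsto_simps)
    fix x
    show "(H has_vector_derivative psinc x * psinc (a - x)) (at x)"
      using dH by (simp add: has_real_derivative_iff_has_vector_derivative)
    show "isCont (\<lambda>u. psinc u * psinc (a - u)) x"
      by (intro continuous_intros isCont_psinc isCont_o2[OF _ isCont_psinc])
  qed simp
  then show ?thesis
    by (simp add: interval_lebesgue_integral_def set_lebesgue_integral_def einterval_def)
qed

text \<open>Translation reduces to a = x - z. The excluded diagonal is a null set in each variable,
  which is all that the use under an integral requires.\<close>

lemma integral_psinc_psinc:
  assumes "x \<noteq> z"
  shows "(\<integral>y. psinc (x - y) * psinc (z - y) \<partial>lborel) = psinc (x - z)"
proof -
  have "(\<integral>y. psinc (x - y) * psinc (z - y) \<partial>lborel) = (\<integral>u. psinc (x - (z + u)) * psinc (z - (z + u)) \<partial>lborel)"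
    using lborel_integral_real_affine[of 1 "\<lambda>y. psinc (x - y) * psinc (z - y)" z] by simp
  also have "\<dots> = (\<integral>u. psinc u * psinc (x - z - u) \<partial>lborel)" by (simp add: mult.commute algebra_simps)
  also have "\<dots> = psinc (x - z)" using assms by (intro integral_psinc_psinc_aux) simp
  finally show ?thesis .
qed

section \<open>Band-limited functions\<close>

text \<open>L2(0,c) extended by zero to the line, so that the operator on the interval and the
  projection on the line act on the same functions. Real values suffice because the kernel is real:
  real and imaginary parts of an eigenfunction are treated separately.\<close>

definition supp_L2 :: "real \<Rightarrow> (real \<Rightarrow> real) set"
  where "supp_L2 c = {f \<in> borel_measurable borel. (\<forall>x. x \<notin> {0<..<c} \<longrightarrow> f x = 0) \<and> integrable lborel (\<lambda>x. (f x)\<^sup>2)}"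

definition bandlimit :: "(real \<Rightarrow> real) \<Rightarrow> real \<Rightarrow> real"
  where "bandlimit f y = (\<integral>x. psinc (x - y) * f x \<partial>lborel)"

lemma supp_L2_measurable [measurable_dest]: "f \<in> supp_L2 c \<Longrightarrow> f \<in> borel_measurable borel"
  by (simp add: supp_L2_def)

lemma supp_L2_zero: "f \<in> supp_L2 c \<Longrightarrow> x \<notin> {0<..<c} \<Longrightarrow> f x = 0"
  by (simp add: supp_L2_def)

lemma supp_L2_sq: "f \<in> supp_L2 c \<Longrightarrow> integrable lborel (\<lambda>x. (f x)\<^sup>2)"
  by (simp add: supp_L2_def)

lemma supp_L2_mult_integrable:
  assumes "f \<in> supp_L2 c" "g \<in> supp_L2 c"
  shows "integrable lborel (\<lambda>x. f x * g x)"
proof (rule Bochner_Integration.integrable_bound)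
  show "integrable lborel (\<lambda>x. (f x)\<^sup>2 + (g x)\<^sup>2)"
    using assms by (intro Bochner_Integration.integrable_add supp_L2_sq)
  show "AE x in lborel. norm (f x * g x) \<le> norm ((f x)\<^sup>2 + (g x)\<^sup>2)"
    using abs_mult_le_squares by auto
qed (use assms in measurable)

lemma supp_L2_integrable:
  assumes "f \<in> supp_L2 c"
  shows "integrable lborel f"
proof (rule Bochner_Integration.integrable_bound)
  show "integrable lborel (\<lambda>x. (f x)\<^sup>2 + indicator {0<..<c} x)"
    using assms by (intro Bochner_Integration.integrable_add supp_L2_sq) (cases "0 \<le> c"; auto)+
  show "AE x in lborel. norm (f x) \<le> norm ((f x)\<^sup>2 + indicator {0<..<c} x :: real)"
  proof (rule AE_I2)
    fix x
    show "norm (f x) \<le> norm ((f x)\<^sup>2 + indicator {0<..<c} x :: real)"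
      using supp_L2_zero[OF assms, of x] abs_mult_le_squares[of "f x" 1]
      by (cases "x \<in> {0<..<c}") auto
  qed
qed (use assms in measurable)

lemma supp_L2_bounded_mult:
  assumes f: "f \<in> supp_L2 c" and g: "g \<in> borel_measurable borel"
    and B: "\<And>x. x \<in> {0<..<c} \<Longrightarrow> \<bar>g x * f x\<bar> \<le> B * \<bar>f x\<bar>"
  shows "(\<lambda>x. g x * f x) \<in> supp_L2 c"
proof -
  have "(g x * f x)\<^sup>2 \<le> B\<^sup>2 * (f x)\<^sup>2" for x
  proof (cases "x \<in> {0<..<c}")
    case True
    from power_mono[OF B[OF this], of 2] show ?thesis by (simp add: power_mult_distrib)
  qed (use supp_L2_zero[OF f] in auto)
  then have "integrable lborel (\<lambda>x. (g x * f x)\<^sup>2)"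
    using f g by (intro Bochner_Integration.integrable_bound[OF integrable_mult_right[OF supp_L2_sq[OF f], of "B\<^sup>2"]]) (measurable, auto)
  then show ?thesis using f g unfolding supp_L2_def by auto
qed

lemma supp_L2_indicator:
  assumes "f \<in> supp_L2 c" "A \<in> sets borel"
  shows "(\<lambda>x. indicator A x * f x) \<in> supp_L2 c"
  using assms by (intro supp_L2_bounded_mult[where B = 1]) (auto simp: indicator_def)

lemma supp_L2_scale: "f \<in> supp_L2 c \<Longrightarrow> (\<lambda>x. a * f x) \<in> supp_L2 c"
  by (intro supp_L2_bounded_mult[where B = "\<bar>a\<bar>"]) (auto simp: abs_mult)

lemma supp_L2_add:
  assumes "f \<in> supp_L2 c" "g \<in> supp_L2 c"
  shows "(\<lambda>x. f x + g x) \<in> supp_L2 c"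
proof -
  have "integrable lborel (\<lambda>x. (f x)\<^sup>2 + (g x)\<^sup>2 + 2 * (f x * g x))"
    using assms by (intro Bochner_Integration.integrable_add integrable_mult_right supp_L2_sq supp_L2_mult_integrable)
  then show ?thesis using assms unfolding supp_L2_def by (auto simp: power2_sum mult.assoc)
qed

lemma supp_L2_sum:
  assumes "\<And>i. i \<in> I \<Longrightarrow> f i \<in> supp_L2 c"
  shows "(\<lambda>x. \<Sum>i\<in>I. f i x) \<in> supp_L2 c"
proof (cases "finite I")
  case True
  then show ?thesis using assms
    by (induction I) (auto simp: supp_L2_add, simp add: supp_L2_def)
qed (simp add: supp_L2_def)

context
  fixes c :: real and f :: "real \<Rightarrow> real"
  assumes f: "f \<in> supp_L2 c"
begin

lemmas [measurable] = supp_L2_measurable[OF f]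

lemma bandlimit_integrable: "integrable lborel (\<lambda>x. psinc (x - y) * f x)"
  by (rule Bochner_Integration.integrable_bound[OF supp_L2_integrable[OF f]])
    (auto simp: abs_mult intro!: mult_left_le_one_le abs_psinc_le_1)

lemma borel_measurable_bandlimit [measurable]: "bandlimit f \<in> borel_measurable borel"
  unfolding bandlimit_def[abs_def] by measurable

text \<open>The majorant for the Fubini arguments: a product involving two kernels or a kernel and
  \<open>bandlimit f\<close> is dominated by a sum of squares, and the integral of
  \<open>psinc\<close> squared does not depend on the shift.\<close>

lemma integrable_psinc_sq_f: "integrable (lborel \<Otimes>\<^sub>M lborel) (\<lambda>(x, y). (psinc (x - y))\<^sup>2 * \<bar>f x\<bar>)"
proof (rule lborel_pair.Fubini_integrable)
  show "integrable lborel (\<lambda>x. \<integral>y. norm (case (x, y) of (x, y) \<Rightarrow> (psinc (x - y))\<^sup>2 * \<bar>f x\<bar>) \<partial>lborel)"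
    using supp_L2_integrable[OF f] by (simp add: abs_mult integral_psinc_sq_shift)
  show "AE x in lborel. integrable lborel (\<lambda>y. case (x, y) of (x, y) \<Rightarrow> (psinc (x - y))\<^sup>2 * \<bar>f x\<bar>)"
    by (intro AE_I2) (simp add: integrable_psinc_sq_shift)
qed measurable

lemma integrable_psinc_sq_f': "integrable (lborel \<Otimes>\<^sub>M lborel) (\<lambda>(y, x). (psinc (x - y))\<^sup>2 * \<bar>f x\<bar>)"
  using lborel_pair.integrable_product_swap[OF integrable_psinc_sq_f] by (simp add: case_prod_beta)

text \<open>Cauchy-Schwarz with respect to the weight |f|. The right side is integrable in y, which
  puts \<open>bandlimit f\<close> into L2 of the line.\<close>

lemma bandlimit_sq_le: "(bandlimit f y)\<^sup>2 \<le> (\<integral>x. \<bar>f x\<bar> \<partial>lborel) * (\<integral>x. (psinc (x - y))\<^sup>2 * \<bar>f x\<bar> \<partial>lborel)"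
proof -
  let ?M = "\<integral>x. \<bar>f x\<bar> \<partial>lborel" and ?b = "\<bar>bandlimit f y\<bar>" and ?J = "\<integral>x. (psinc (x - y))\<^sup>2 * \<bar>f x\<bar> \<partial>lborel"
  have fi: "integrable lborel (\<lambda>x. \<bar>f x\<bar>)" using supp_L2_integrable[OF f] by simp
  have Ji: "integrable lborel (\<lambda>x. (psinc (x - y))\<^sup>2 * \<bar>f x\<bar>)"
    by (rule Bochner_Integration.integrable_bound[OF supp_L2_integrable[OF f]])
      (use abs_psinc_le_1 in \<open>auto simp: abs_mult abs_square_le_1 intro!: mult_left_le_one_le\<close>)
  have bi: "integrable lborel (\<lambda>x. \<bar>psinc (x - y) * f x\<bar>)" using bandlimit_integrable by simp
  have b: "?b \<le> (\<integral>x. \<bar>psinc (x - y) * f x\<bar> \<partial>lborel)"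
    unfolding bandlimit_def by (rule integral_abs_bound)
  have M0: "0 \<le> ?M" by simp
  show ?thesis
  proof (cases "?M = 0")
    case True
    have "(\<integral>x. \<bar>psinc (x - y) * f x\<bar> \<partial>lborel) \<le> ?M"
      by (intro integral_mono bi fi) (auto simp: abs_mult intro!: mult_left_le_one_le abs_psinc_le_1)
    with True b have "bandlimit f y = 0" by simp
    with True show ?thesis by simp
  next
    case False
    with M0 have M: "0 < ?M" by linarith
    have "?b * ?b \<le> ?b * (\<integral>x. \<bar>psinc (x - y) * f x\<bar> \<partial>lborel)"
      using b by (intro mult_left_mono) auto
    also have "\<dots> = (\<integral>x. ?b * \<bar>psinc (x - y) * f x\<bar> \<partial>lborel)" by simp
    also have "\<dots> \<le> (\<integral>x. (?M / 2) * ((psinc (x - y))\<^sup>2 * \<bar>f x\<bar>) + (?b\<^sup>2 / (2 * ?M)) * \<bar>f x\<bar> \<partial>lborel)"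
    proof (intro integral_mono Bochner_Integration.integrable_add integrable_mult_right bi fi Ji)
      fix x
      \<comment> \<open>Completing the square with the parameter \<open>?M\<close> lets half of the
        squared left side be absorbed after integration. The case \<open>?M\<close> = 0 was split
        off because of this division.\<close>
      have "0 \<le> (?M * \<bar>psinc (x - y)\<bar> - ?b)\<^sup>2 / (2 * ?M)" using M by simp
      also have "\<dots> = (?M / 2) * (psinc (x - y))\<^sup>2 + ?b\<^sup>2 / (2 * ?M) - ?b * \<bar>psinc (x - y)\<bar>"
      proof -
        have "(m * p - b)\<^sup>2 / (2 * m) = (m / 2) * p\<^sup>2 + b\<^sup>2 / (2 * m) - b * p" if "0 < m" for m p b :: real
          using that by (simp add: field_simps power2_eq_square)
        from this[OF M, of "\<bar>psinc (x - y)\<bar>" ?b] show ?thesis by simp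
      qed
      finally have "?b * \<bar>psinc (x - y)\<bar> * \<bar>f x\<bar> \<le> ((?M / 2) * (psinc (x - y))\<^sup>2 + ?b\<^sup>2 / (2 * ?M)) * \<bar>f x\<bar>"
        by (intro mult_right_mono) auto
      then show "?b * \<bar>psinc (x - y) * f x\<bar> \<le> (?M / 2) * ((psinc (x - y))\<^sup>2 * \<bar>f x\<bar>) + (?b\<^sup>2 / (2 * ?M)) * \<bar>f x\<bar>"
        by (simp add: abs_mult distrib_right mult.assoc)
    qed
    also have "\<dots> = (?M / 2) * ?J + (?b\<^sup>2 / (2 * ?M)) * ?M"
      using fi Ji by simp
    also have "\<dots> = ?M * ?J / 2 + ?b * ?b / 2" using M by (simp add: power2_eq_square)
    finally have "?b * ?b \<le> ?M * ?J" by linarith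
    then show ?thesis by (simp add: power2_eq_square)
  qed
qed

lemma integrable_bandlimit_sq: "integrable lborel (\<lambda>y. (bandlimit f y)\<^sup>2)"
proof (rule Bochner_Integration.integrable_bound)
  show "integrable lborel (\<lambda>y. (\<integral>x. \<bar>f x\<bar> \<partial>lborel) * (\<integral>x. (psinc (x - y))\<^sup>2 * \<bar>f x\<bar> \<partial>lborel))"
    using lborel_pair.integrable_fst'[OF integrable_psinc_sq_f'] by simp
  show "AE y in lborel. norm ((bandlimit f y)\<^sup>2) \<le> norm ((\<integral>x. \<bar>f x\<bar> \<partial>lborel) * (\<integral>x. (psinc (x - y))\<^sup>2 * \<bar>f x\<bar> \<partial>lborel))"
    using bandlimit_sq_le by (auto intro: order_trans)
qed measurable

text \<open>The projection is idempotent: after Fubini the inner integral is the convolution of the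
  kernel with itself.\<close>

lemma bandlimit_reproducing: "(\<integral>y. psinc (z - y) * bandlimit f y \<partial>lborel) = bandlimit f z"
proof -
  have int: "integrable (lborel \<Otimes>\<^sub>M lborel) (\<lambda>(x, y). psinc (z - y) * (psinc (x - y) * f x))"
  proof (rule Bochner_Integration.integrable_bound)
    have "integrable (lborel \<Otimes>\<^sub>M lborel) (\<lambda>(x, y). \<bar>f x\<bar> * (psinc (z - y))\<^sup>2)"
      using supp_L2_integrable[OF f] integrable_psinc_sq_shift[of z]
      by (intro lborel_pair.Fubini_integrable) (auto simp: abs_mult)
    then show "integrable (lborel \<Otimes>\<^sub>M lborel) (\<lambda>p. (case p of (x, y) \<Rightarrow> (psinc (x - y))\<^sup>2 * \<bar>f x\<bar>) + (case p of (x, y) \<Rightarrow> \<bar>f x\<bar> * (psinc (z - y))\<^sup>2))"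
      by (intro Bochner_Integration.integrable_add integrable_psinc_sq_f)
    show "AE p in lborel \<Otimes>\<^sub>M lborel. norm (case p of (x, y) \<Rightarrow> psinc (z - y) * (psinc (x - y) * f x))
      \<le> norm ((case p of (x, y) \<Rightarrow> (psinc (x - y))\<^sup>2 * \<bar>f x\<bar>) + (case p of (x, y) \<Rightarrow> \<bar>f x\<bar> * (psinc (z - y))\<^sup>2))"
    proof (rule AE_I2)
      fix p :: "real \<times> real"
      obtain x y where p: "p = (x, y)" by fastforce
      have "\<bar>psinc (z - y) * psinc (x - y)\<bar> * \<bar>f x\<bar> \<le> ((psinc (z - y))\<^sup>2 + (psinc (x - y))\<^sup>2) * \<bar>f x\<bar>"
        by (intro mult_right_mono abs_mult_le_squares) auto
      then show "norm (case p of (x, y) \<Rightarrow> psinc (z - y) * (psinc (x - y) * f x))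
      \<le> norm ((case p of (x, y) \<Rightarrow> (psinc (x - y))\<^sup>2 * \<bar>f x\<bar>) + (case p of (x, y) \<Rightarrow> \<bar>f x\<bar> * (psinc (z - y))\<^sup>2))"
        by (simp add: p abs_mult algebra_simps abs_of_nonneg)
    qed
  qed measurable
  have "(\<integral>y. psinc (z - y) * bandlimit f y \<partial>lborel) = (\<integral>y. (\<integral>x. psinc (z - y) * (psinc (x - y) * f x) \<partial>lborel) \<partial>lborel)"
    by (simp add: bandlimit_def)
  also have "\<dots> = (\<integral>x. (\<integral>y. psinc (z - y) * (psinc (x - y) * f x) \<partial>lborel) \<partial>lborel)"
    by (rule lborel_pair.Fubini_integral[OF int])
  also have "\<dots> = (\<integral>x. psinc (x - z) * f x \<partial>lborel)"
  proof (rule integral_cong_AE)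
    \<comment> \<open>The convolution identity was proved off the diagonal only; the single point x
      = z is discarded.\<close>
    show "AE x in lborel. (\<integral>y. psinc (z - y) * (psinc (x - y) * f x) \<partial>lborel) = psinc (x - z) * f x"
      using AE_lborel_singleton[of z]
    proof eventually_elim
      case (elim x)
      have "(\<integral>y. psinc (z - y) * (psinc (x - y) * f x) \<partial>lborel) = (\<integral>y. psinc (x - y) * psinc (z - y) * f x \<partial>lborel)"
        by (simp add: mult_ac)
      also have "\<dots> = psinc (x - z) * f x" using integral_psinc_psinc[OF elim] by simp
      finally show ?case .
    qed
  qed measurable
  finally show ?thesis by (simp add: bandlimit_def)
qed

lemma integrable_f_bandlimit: "integrable lborel (\<lambda>x. f x * bandlimit f x)"
  by (rule Bochner_Integration.integrable_bound[OF Bochner_Integration.integrable_add[OF supp_L2_sq[OF f] integrable_bandlimit_sq]])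
    (use abs_mult_le_squares in auto)

text \<open>The identity |P f|^2 = <P f, f> for a self-adjoint idempotent. Its value is that the
  energy of P f on the whole line is read off where \<open>f\<close> lives.\<close>

lemma integral_bandlimit_sq: "(\<integral>y. (bandlimit f y)\<^sup>2 \<partial>lborel) = (\<integral>x. f x * bandlimit f x \<partial>lborel)"
proof -
  have int: "integrable (lborel \<Otimes>\<^sub>M lborel) (\<lambda>(x, y). bandlimit f y * (psinc (x - y) * f x))"
  proof (rule Bochner_Integration.integrable_bound)
    have "integrable (lborel \<Otimes>\<^sub>M lborel) (\<lambda>(x, y). \<bar>f x\<bar> * (bandlimit f y)\<^sup>2)"
      using supp_L2_integrable[OF f] integrable_bandlimit_sq
      by (intro lborel_pair.Fubini_integrable) (auto simp: abs_mult)
    then show "integrable (lborel \<Otimes>\<^sub>M lborel) (\<lambda>p. (case p of (x, y) \<Rightarrow> (psinc (x - y))\<^sup>2 * \<bar>f x\<bar>) + (case p of (x, y) \<Rightarrow> \<bar>f x\<bar> * (bandlimit f y)\<^sup>2))"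
      by (intro Bochner_Integration.integrable_add integrable_psinc_sq_f)
    show "AE p in lborel \<Otimes>\<^sub>M lborel. norm (case p of (x, y) \<Rightarrow> bandlimit f y * (psinc (x - y) * f x))
      \<le> norm ((case p of (x, y) \<Rightarrow> (psinc (x - y))\<^sup>2 * \<bar>f x\<bar>) + (case p of (x, y) \<Rightarrow> \<bar>f x\<bar> * (bandlimit f y)\<^sup>2))"
    proof (rule AE_I2)
      fix p :: "real \<times> real"
      obtain x y where p: "p = (x, y)" by fastforce
      have "\<bar>bandlimit f y * psinc (x - y)\<bar> * \<bar>f x\<bar> \<le> ((bandlimit f y)\<^sup>2 + (psinc (x - y))\<^sup>2) * \<bar>f x\<bar>"
        by (intro mult_right_mono abs_mult_le_squares) auto
      then show "norm (case p of (x, y) \<Rightarrow> bandlimit f y * (psinc (x - y) * f x))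
      \<le> norm ((case p of (x, y) \<Rightarrow> (psinc (x - y))\<^sup>2 * \<bar>f x\<bar>) + (case p of (x, y) \<Rightarrow> \<bar>f x\<bar> * (bandlimit f y)\<^sup>2))"
        by (simp add: p abs_mult algebra_simps abs_of_nonneg)
    qed
  qed measurable
  have "(\<integral>y. (bandlimit f y)\<^sup>2 \<partial>lborel) = (\<integral>y. (\<integral>x. bandlimit f y * (psinc (x - y) * f x) \<partial>lborel) \<partial>lborel)"
    by (simp add: power2_eq_square) (simp add: bandlimit_def)
  also have "\<dots> = (\<integral>x. (\<integral>y. bandlimit f y * (psinc (x - y) * f x) \<partial>lborel) \<partial>lborel)"
    by (rule lborel_pair.Fubini_integral[OF int])
  also have "\<dots> = (\<integral>x. (\<integral>y. f x * (psinc (x - y) * bandlimit f y) \<partial>lborel) \<partial>lborel)"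
    by (simp only: mult_ac)
  also have "\<dots> = (\<integral>x. f x * bandlimit f x \<partial>lborel)" by (simp add: bandlimit_reproducing)
  finally show ?thesis .
qed

text \<open>From |P f|^2 = <f, P f> <= |f|^2 / 2 + |P f|^2 / 2, absorbing the last term.\<close>

lemma integral_bandlimit_sq_le: "(\<integral>y. (bandlimit f y)\<^sup>2 \<partial>lborel) \<le> (\<integral>x. (f x)\<^sup>2 \<partial>lborel)"
proof -
  have "(\<integral>x. f x * bandlimit f x \<partial>lborel) \<le> (\<integral>x. (1/2) * (f x)\<^sup>2 + (1/2) * (bandlimit f x)\<^sup>2 \<partial>lborel)"
  proof (intro integral_mono integrable_f_bandlimit Bochner_Integration.integrable_add integrable_mult_right supp_L2_sq[OF f] integrable_bandlimit_sq)
    fix x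
    show "f x * bandlimit f x \<le> (1/2) * (f x)\<^sup>2 + (1/2) * (bandlimit f x)\<^sup>2"
      using sum_squares_bound[of "f x" "bandlimit f x"] by simp
  qed
  also have "\<dots> = (1/2) * (\<integral>x. (f x)\<^sup>2 \<partial>lborel) + (1/2) * (\<integral>y. (bandlimit f y)\<^sup>2 \<partial>lborel)"
    using supp_L2_sq[OF f] integrable_bandlimit_sq by simp
  finally show ?thesis unfolding integral_bandlimit_sq[symmetric] by simp
qed

end

section \<open>Band-limited energy of functions living on one piece of the interval\<close>

lemma supp_L2_compact_mult:
  assumes f: "f \<in> supp_L2 c" and g: "g \<in> borel_measurable borel" "continuous_on K g"
    and K: "compact K" "\<And>x. x \<notin> K \<Longrightarrow> f x = 0"
  shows "(\<lambda>x. g x * f x) \<in> supp_L2 c"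
proof -
  \<comment> \<open>Only values on \<open>K\<close> matter, so \<open>g\<close> may have poles
    elsewhere; it will be a quotient with denominator D.\<close>
  have "bounded (g ` K)" using K(1) g(2) by (intro compact_imp_bounded compact_continuous_image)
  then obtain B where B: "\<And>x. x \<in> K \<Longrightarrow> \<bar>g x\<bar> \<le> B" unfolding bounded_iff by auto
  show ?thesis
  proof (rule supp_L2_bounded_mult[OF f g(1)])
    fix x
    show "\<bar>g x * f x\<bar> \<le> B * \<bar>f x\<bar>"
      using B[of x] K(2)[of x] by (cases "x \<in> K") (auto simp: abs_mult intro: mult_right_mono)
  qed
qed

lemma supp_L2_continuous_mult:
  assumes f: "f \<in> supp_L2 c" and g: "continuous_on UNIV g"
  shows "(\<lambda>x. g x * f x) \<in> supp_L2 c"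
  using supp_L2_zero[OF f]
  by (intro supp_L2_compact_mult[OF f borel_measurable_continuous_onI[OF g], of "{0..c}"])
     (auto intro: continuous_on_subset[OF g])

lemma bandlimit_add:
  assumes "f \<in> supp_L2 c" "g \<in> supp_L2 c"
  shows "bandlimit (\<lambda>x. f x + g x) y = bandlimit f y + bandlimit g y"
  using bandlimit_integrable[OF assms(1)] bandlimit_integrable[OF assms(2)]
  by (simp add: bandlimit_def distrib_left)

text \<open>The sine series divided by its argument, whence the shift in
  \<open>sin_coeff (Suc j)\<close>; the remainder is the Maclaurin remainder of sine of order n + 1,
  weakened to a factorial of n.\<close>

lemma psinc_taylor:
  "\<bar>psinc t - (\<Sum>j<n. sin_coeff (Suc j) * (pi * t) ^ j)\<bar> \<le> (pi * \<bar>t\<bar>) ^ n / fact n"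
proof (cases "t = 0")
  case True
  then show ?thesis by (cases n) (simp_all add: psinc_def sum.lessThan_Suc_shift sin_coeff_def del: sum.lessThan_Suc)
next
  case False
  let ?x = "pi * t" and ?S = "\<Sum>j<n. sin_coeff (Suc j) * (pi * t) ^ j"
  have x: "?x \<noteq> 0" using False by simp
  have "\<bar>sin ?x - (\<Sum>m<Suc n. sin_coeff m * ?x ^ m)\<bar> \<le> inverse (fact (Suc n)) * \<bar>?x\<bar> ^ Suc n"
    by (rule Maclaurin_sin_bound)
  also have "(\<Sum>m<Suc n. sin_coeff m * ?x ^ m) = ?x * ?S"
    unfolding sum.lessThan_Suc_shift by (simp add: sum_distrib_left mult_ac)
  also have "sin ?x = ?x * psinc t" using psinc_sin by simp
  finally have "\<bar>?x\<bar> * \<bar>psinc t - ?S\<bar> \<le> \<bar>?x\<bar> * (\<bar>?x\<bar> ^ n / fact (Suc n))"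
    unfolding abs_mult[symmetric] right_diff_distrib by (simp add: divide_inverse mult_ac del: fact_Suc)
  moreover have "0 < \<bar>?x\<bar>" using x by simp
  ultimately have "\<bar>psinc t - ?S\<bar> \<le> \<bar>?x\<bar> ^ n / fact (Suc n)" by (simp only: mult_le_cancel_left_pos)
  also have "\<dots> \<le> \<bar>?x\<bar> ^ n / fact n" by (intro divide_left_mono fact_mono) auto
  finally show ?thesis by (simp add: abs_mult)
qed

text \<open>The Taylor polynomial of the kernel is centred at the evaluation point x, whereas the
  conditions imposed on \<open>f\<close> must not depend on x. The binomial theorem passes from one
  to the other.\<close>

lemma moments_shift:
  assumes f: "f \<in> supp_L2 c" and m: "\<And>j. j < n \<Longrightarrow> (\<integral>x. x ^ j * f x \<partial>lborel) = 0" and "j < n"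
  shows "(\<integral>z. (z - x) ^ j * f z \<partial>lborel) = 0"
proof -
  have int: "integrable lborel (\<lambda>z. z ^ i * f z)" for i
    by (intro supp_L2_integrable[OF supp_L2_continuous_mult[OF f]] continuous_intros)
  have "(z - x) ^ j * f z = (\<Sum>i\<le>j. (of_nat (j choose i) * (- x) ^ (j - i)) * (z ^ i * f z))" for z
    using binomial_ring[of z "- x" j] by (simp add: sum_distrib_right sum_distrib_left mult_ac)
  then have "(\<integral>z. (z - x) ^ j * f z \<partial>lborel) = (\<Sum>i\<le>j. (of_nat (j choose i) * (- x) ^ (j - i)) * (\<integral>z. z ^ i * f z \<partial>lborel))"
    using int by simp
  also have "\<dots> = 0" using m assms(3) by simp
  finally show ?thesis .
qed

text \<open>Cauchy-Schwarz on an interval of length 2, by integrating m |f| <= f^2 + m^2 / 4 over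
  it.\<close>

lemma L1_sq_le_L2_interval2:
  assumes f: "f \<in> supp_L2 c" and z: "\<And>x. x \<notin> {a..a+2} \<Longrightarrow> f x = 0"
  shows "(\<integral>x. \<bar>f x\<bar> \<partial>lborel)\<^sup>2 \<le> 2 * (\<integral>x. (f x)\<^sup>2 \<partial>lborel)"
proof -
  let ?m = "\<integral>x. \<bar>f x\<bar> \<partial>lborel"
  have "?m * ?m = (\<integral>x. ?m * \<bar>f x\<bar> \<partial>lborel)" by simp
  also have "\<dots> \<le> (\<integral>x. (f x)\<^sup>2 + (?m\<^sup>2 / 4) * indicator {a..a+2} x \<partial>lborel)"
  proof (intro integral_mono Bochner_Integration.integrable_add integrable_mult_right supp_L2_sq[OF f])
    show "integrable lborel (\<lambda>x. \<bar>f x\<bar>)" using supp_L2_integrable[OF f] by simp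
    show "integrable lborel (indicator {a..a+2} :: real \<Rightarrow> real)" by simp
    fix x
    have "0 \<le> (\<bar>f x\<bar> - ?m / 2)\<^sup>2" by simp
    then have "?m * \<bar>f x\<bar> \<le> (f x)\<^sup>2 + ?m\<^sup>2 / 4" by (simp add: power2_diff power_divide mult.commute)
    then show "?m * \<bar>f x\<bar> \<le> (f x)\<^sup>2 + (?m\<^sup>2 / 4) * indicator {a..a+2} x"
      using z[of x] by (cases "x \<in> {a..a+2}") auto
  qed
  also have "\<dots> = (\<integral>x. (f x)\<^sup>2 \<partial>lborel) + (?m\<^sup>2 / 4) * 2"
    using supp_L2_sq[OF f] by simp
  finally show ?thesis by (simp add: power2_eq_square)
qed

text \<open>The energy on the whole line equals <f, P f>, so P f matters only on the interval
  itself. There arguments of the kernel are at most 2 in size, and the moments annihilate its Taylor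
  polynomial.\<close>

lemma bandlimit_energy_short_interval:
  assumes f: "f \<in> supp_L2 c" and z: "\<And>x. x \<notin> {a..a+2} \<Longrightarrow> f x = 0"
    and m: "\<And>j. j < n \<Longrightarrow> (\<integral>x. x ^ j * f x \<partial>lborel) = 0"
  shows "(\<integral>y. (bandlimit f y)\<^sup>2 \<partial>lborel) \<le> 2 * ((2 * pi) ^ n / fact n) * (\<integral>x. (f x)\<^sup>2 \<partial>lborel)"
proof -
  let ?e = "(2 * pi) ^ n / fact n" and ?M = "\<integral>x. \<bar>f x\<bar> \<partial>lborel"
  have fi: "integrable lborel (\<lambda>x. \<bar>f x\<bar>)" using supp_L2_integrable[OF f] by simp
  have b: "\<bar>bandlimit f x\<bar> \<le> ?e * ?M" if x: "x \<in> {a..a+2}" for x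
  proof -
    have Si: "integrable lborel (\<lambda>z. (\<Sum>j<n. sin_coeff (Suc j) * (pi * (z - x)) ^ j) * f z)"
      by (intro supp_L2_integrable[OF supp_L2_continuous_mult[OF f]] continuous_intros)
    have ti: "integrable lborel (\<lambda>z. (z - x) ^ j * f z)" for j
      by (intro supp_L2_integrable[OF supp_L2_continuous_mult[OF f]] continuous_intros)
    have "(\<integral>z. (\<Sum>j<n. sin_coeff (Suc j) * (pi * (z - x)) ^ j) * f z \<partial>lborel)
      = (\<integral>z. (\<Sum>j<n. (sin_coeff (Suc j) * pi ^ j) * ((z - x) ^ j * f z)) \<partial>lborel)"
      by (simp add: sum_distrib_right sum_distrib_left power_mult_distrib mult_ac)
    also have "\<dots> = (\<Sum>j<n. (sin_coeff (Suc j) * pi ^ j) * (\<integral>z. (z - x) ^ j * f z \<partial>lborel))"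
      using ti by simp
    also have "\<dots> = 0" using moments_shift[OF f m] by simp
    finally have "bandlimit f x = (\<integral>z. psinc (z - x) * f z - (\<Sum>j<n. sin_coeff (Suc j) * (pi * (z - x)) ^ j) * f z \<partial>lborel)"
      using bandlimit_integrable[OF f] Si by (simp add: bandlimit_def)
    also have "\<bar>\<dots>\<bar> \<le> (\<integral>z. \<bar>psinc (z - x) * f z - (\<Sum>j<n. sin_coeff (Suc j) * (pi * (z - x)) ^ j) * f z\<bar> \<partial>lborel)"
      by (rule integral_abs_bound)
    also have "\<dots> \<le> (\<integral>z. ?e * \<bar>f z\<bar> \<partial>lborel)"
    proof (intro integral_mono integrable_abs Bochner_Integration.integrable_diff integrable_mult_right bandlimit_integrable[OF f] Si fi)
      fix u
      show "\<bar>psinc (u - x) * f u - (\<Sum>j<n. sin_coeff (Suc j) * (pi * (u - x)) ^ j) * f u\<bar> \<le> ?e * \<bar>f u\<bar>"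
      proof (cases "u \<in> {a..a+2}")
        case True
        have "\<bar>u - x\<bar> \<le> 2" using True x by auto
        then have "(pi * \<bar>u - x\<bar>) ^ n / fact n \<le> (pi * 2) ^ n / fact n"
          by (intro divide_right_mono power_mono mult_left_mono) auto
        with psinc_taylor[of "u - x" n] have "\<bar>psinc (u - x) - (\<Sum>j<n. sin_coeff (Suc j) * (pi * (u - x)) ^ j)\<bar> \<le> ?e"
          by (simp add: mult.commute)
        from mult_right_mono[OF this, of "\<bar>f u\<bar>"] show ?thesis
          by (simp add: abs_mult[symmetric] left_diff_distrib)
      qed (use z in simp)
    qed (use supp_L2_integrable[OF f] in auto)
    finally show ?thesis using fi by simp
  qed
  have "(\<integral>y. (bandlimit f y)\<^sup>2 \<partial>lborel) = (\<integral>x. f x * bandlimit f x \<partial>lborel)"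
    by (rule integral_bandlimit_sq[OF f])
  also have "\<dots> \<le> (\<integral>x. (?e * ?M) * \<bar>f x\<bar> \<partial>lborel)"
  proof (intro integral_mono integrable_f_bandlimit[OF f] integrable_mult_right fi)
    fix x
    have "f x * bandlimit f x \<le> \<bar>f x\<bar> * \<bar>bandlimit f x\<bar>" by (metis abs_ge_self abs_mult)
    also have "\<dots> \<le> \<bar>f x\<bar> * (?e * ?M)"
    proof (cases "x \<in> {a..a+2}")
      case True then show ?thesis using b by (intro mult_left_mono) auto
    qed (use z in simp)
    finally show "f x * bandlimit f x \<le> (?e * ?M) * \<bar>f x\<bar>" by (simp add: mult.commute)
  qed
  also have "\<dots> = ?e * ?M\<^sup>2" using fi by (simp add: power2_eq_square)
  also have "\<dots> \<le> ?e * (2 * (\<integral>x. (f x)\<^sup>2 \<partial>lborel))"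
    by (intro mult_left_mono L1_sq_le_L2_interval2[OF f z]) auto
  finally show ?thesis by (simp add: mult_ac)
qed

text \<open>Modulo the vanishing integrals, \<open>1 / (x - y)\<close> may be replaced by
  \<open>N x D y / (D x N y (x - y))\<close>, because the difference is a polynomial in \<open>x\<close> divided by \<open>D x\<close>.\<close>

lemma bandlimit_outside_middle:
  fixes N D :: "real poly"
  assumes f: "f \<in> supp_L2 c" and z: "\<And>x. x \<notin> {a..b} \<Longrightarrow> f x = 0"
    and k: "degree N \<le> k" "degree D \<le> k" "0 < k"
    and E: "\<And>x. x \<in> {a..b} \<Longrightarrow> poly D x \<noteq> 0 \<and> \<bar>poly N x / poly D x\<bar> \<le> \<epsilon>"
    and F: "\<And>y. y \<in> Y \<Longrightarrow> poly N y \<noteq> 0 \<and> \<bar>poly D y / poly N y\<bar> \<le> \<epsilon>"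
    and Y: "Y \<in> sets borel"
    and s: "\<And>i. i < k \<Longrightarrow> (\<integral>x. (sin (pi * x) * x ^ i / poly D x) * f x \<partial>lborel) = 0"
    and co: "\<And>i. i < k \<Longrightarrow> (\<integral>x. (cos (pi * x) * x ^ i / poly D x) * f x \<partial>lborel) = 0"
    and \<epsilon>: "0 \<le> \<epsilon>"
  shows "(\<integral>y. indicator Y y * (bandlimit f y)\<^sup>2 \<partial>lborel) \<le> \<epsilon> ^ 4 * (\<integral>x. (f x)\<^sup>2 \<partial>lborel)"
proof -
  have pm [measurable]: "poly p \<in> borel_measurable borel" for p :: "real poly"
    by (intro borel_measurable_continuous_onI continuous_intros)
  \<comment> \<open>The factor depending on x is moved into the function; the one depending on y
    remains in front of \<open>bandlimit h y\<close>.\<close>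
  define h where "h = (\<lambda>x. poly N x / poly D x * f x)"
  have hf: "\<bar>h x\<bar> \<le> \<epsilon> * \<bar>f x\<bar>" for x
  proof (cases "x \<in> {a..b}")
    case True
    from mult_right_mono[OF conjunct2[OF E[OF this]], of "\<bar>f x\<bar>"] show ?thesis
      by (simp only: h_def abs_mult abs_ge_zero)
  qed (use z h_def in simp)
  have h: "h \<in> supp_L2 c"
    unfolding h_def using hf by (intro supp_L2_bounded_mult[OF f]) (auto simp: h_def)
  have Dnz: "\<forall>x\<in>{a..b}. poly D x \<noteq> 0" using E by blast
  have si: "integrable lborel (\<lambda>x. (sin (pi * x) * x ^ i / poly D x) * f x)" for i
    by (rule supp_L2_integrable[OF supp_L2_compact_mult[OF f _ continuous_on_divide[OF _ _ Dnz] _ z]])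
      (auto intro!: continuous_intros)
  have ci: "integrable lborel (\<lambda>x. (cos (pi * x) * x ^ i / poly D x) * f x)" for i
    by (rule supp_L2_integrable[OF supp_L2_compact_mult[OF f _ continuous_on_divide[OF _ _ Dnz] _ z]])
      (auto intro!: continuous_intros)
  have key: "bandlimit f y = poly D y / poly N y * bandlimit h y" if y: "y \<in> Y" for y
  proof -
    let ?A = "poly N y" and ?B = "poly D y"
    have A: "?A \<noteq> 0" using F[OF y] by simp
    obtain q where q: "\<And>x. ?A * poly D x - ?B * poly N x = (x - y) * (\<Sum>i<k. q i * x ^ i)"
      using bezoutian_quotient[OF k, of y] by blast
    \<comment> \<open>The Bezoutian cancels x - y in the kernel, leaving sin (pi (x - y)) times a
      polynomial in x over D x. The addition formula separates x from y, at the price of one sine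
      and one cosine condition per power of x.\<close>
    have pt: "psinc (x - y) * f x - ?B / ?A * (psinc (x - y) * h x) =
      (\<Sum>i<k. (cos (pi * y) * q i / (pi * ?A)) * ((sin (pi * x) * x ^ i / poly D x) * f x)
            - (sin (pi * y) * q i / (pi * ?A)) * ((cos (pi * x) * x ^ i / poly D x) * f x))" (is "?l = ?r") for x
    proof (cases "x \<in> {a..b}")
      case True
      then have D: "poly D x \<noteq> 0" using E by simp
      have "?l = psinc (x - y) * (?A * poly D x - ?B * poly N x) / (?A * poly D x) * f x"
        using A D by (simp add: h_def field_simps)
      also have "\<dots> = (pi * (x - y) * psinc (x - y)) * (\<Sum>i<k. q i * x ^ i) / (pi * ?A * poly D x) * f x"
        unfolding q by simp
      also have "\<dots> = (\<Sum>i<k. (sin (pi * x) * cos (pi * y) - cos (pi * x) * sin (pi * y)) * (q i * x ^ i) / (pi * ?A * poly D x) * f x)"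
        unfolding psinc_sin unfolding right_diff_distrib[of pi] sin_diff by (simp add: sum_distrib_left sum_distrib_right sum_divide_distrib)
      also have "\<dots> = ?r"
        by (intro sum.cong refl) (simp add: left_diff_distrib right_diff_distrib diff_divide_distrib mult_ac)
      finally show ?thesis .
    qed (use z h_def in simp)
    have "bandlimit f y - ?B / ?A * bandlimit h y = (\<integral>x. psinc (x - y) * f x - ?B / ?A * (psinc (x - y) * h x) \<partial>lborel)"
      using bandlimit_integrable[OF f] bandlimit_integrable[OF h] by (simp add: bandlimit_def)
    also have "\<dots> = (\<Sum>i<k. (cos (pi * y) * q i / (pi * ?A)) * (\<integral>x. (sin (pi * x) * x ^ i / poly D x) * f x \<partial>lborel)
            - (sin (pi * y) * q i / (pi * ?A)) * (\<integral>x. (cos (pi * x) * x ^ i / poly D x) * f x \<partial>lborel))"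
      unfolding pt using si ci
      by (subst Bochner_Integration.integral_sum)
         (auto intro!: Bochner_Integration.integrable_diff integrable_mult_right sum.cong simp del: times_divide_eq_left times_divide_eq_right)
    also have "\<dots> = 0" using s co by simp
    finally show ?thesis by simp
  qed
  \<comment> \<open>Source of the fourth power: D/N at the outside point gives one square of the
    small factor, N/D inside \<open>h\<close> the other, with the contraction property in
    between.\<close>
  have "(\<integral>y. indicator Y y * (bandlimit f y)\<^sup>2 \<partial>lborel) \<le> (\<integral>y. \<epsilon>\<^sup>2 * (bandlimit h y)\<^sup>2 \<partial>lborel)"
  proof (rule integral_mono)
    show "integrable lborel (\<lambda>y. indicator Y y * (bandlimit f y)\<^sup>2)"
      using integrable_mult_indicator[OF _ integrable_bandlimit_sq[OF f], of Y] Y by simp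
    show "integrable lborel (\<lambda>y. \<epsilon>\<^sup>2 * (bandlimit h y)\<^sup>2)"
      using integrable_bandlimit_sq[OF h] by simp
    fix y
    show "indicator Y y * (bandlimit f y)\<^sup>2 \<le> \<epsilon>\<^sup>2 * (bandlimit h y)\<^sup>2"
    proof (cases "y \<in> Y")
      case True
      have "(poly D y / poly N y)\<^sup>2 \<le> \<epsilon>\<^sup>2"
        using F[OF True] \<epsilon> by (intro power2_le_iff_abs_le[THEN iffD2]) auto
      then have "(poly D y / poly N y)\<^sup>2 * (bandlimit h y)\<^sup>2 \<le> \<epsilon>\<^sup>2 * (bandlimit h y)\<^sup>2"
        by (intro mult_right_mono) auto
      then show ?thesis using True unfolding key[OF True] power_mult_distrib by simp
    qed simp
  qed
  also have "\<dots> = \<epsilon>\<^sup>2 * (\<integral>y. (bandlimit h y)\<^sup>2 \<partial>lborel)" by simp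
  also have "\<dots> \<le> \<epsilon>\<^sup>2 * (\<integral>x. (h x)\<^sup>2 \<partial>lborel)"
    by (intro mult_left_mono integral_bandlimit_sq_le[OF h]) auto
  also have "\<dots> \<le> \<epsilon>\<^sup>2 * (\<integral>x. \<epsilon>\<^sup>2 * (f x)\<^sup>2 \<partial>lborel)"
  proof (intro mult_left_mono integral_mono supp_L2_sq[OF h] integrable_mult_right supp_L2_sq[OF f])
    fix x
    show "(h x)\<^sup>2 \<le> \<epsilon>\<^sup>2 * (f x)\<^sup>2" using power_mono[OF hf[of x], of 2] by (simp add: power_mult_distrib)
  qed auto
  also have "\<dots> = \<epsilon> ^ 4 * (\<integral>x. (f x)\<^sup>2 \<partial>lborel)" by (simp add: power2_eq_square power4_eq_xxxx)
  finally show ?thesis .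
qed

section \<open>Energy outside the interval\<close>

text \<open>More unknowns than equations: each equation with a non-zero coefficient eliminates one
  unknown, as in Gaussian elimination.\<close>

lemma homogeneous_system_nontrivial:
  fixes A :: "'e \<Rightarrow> 'j \<Rightarrow> real"
  assumes "finite J" "length es < card J"
  shows "\<exists>a. (\<exists>j\<in>J. a j \<noteq> 0) \<and> (\<forall>e\<in>set es. (\<Sum>j\<in>J. a j * A e j) = 0)"
  using assms
proof (induction es arbitrary: J A)
  case Nil
  then have "J \<noteq> {}" by auto
  then show ?case by (intro exI[of _ "\<lambda>_. 1"]) auto
next
  case (Cons e es)
  show ?case
  proof (cases "\<forall>j\<in>J. A e j = 0")
    case True
    obtain a where "\<exists>j\<in>J. a j \<noteq> 0" "\<forall>e\<in>set es. (\<Sum>j\<in>J. a j * A e j) = 0"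
      using Cons.IH[of J A] Cons.prems by auto
    with True show ?thesis by (intro exI[of _ a]) auto
  next
    case False
    then obtain p where p: "p \<in> J" "A e p \<noteq> 0" by blast
    let ?J = "J - {p}"
    have fin: "finite ?J" using Cons.prems by simp
    have "length es < card ?J" using Cons.prems p by simp
    from Cons.IH[OF fin this, of "\<lambda>e' j. A e' j - A e' p * A e j / A e p"]
    obtain a where a: "\<exists>j\<in>?J. a j \<noteq> 0"
      "\<And>e'. e' \<in> set es \<Longrightarrow> (\<Sum>j\<in>?J. a j * (A e' j - A e' p * A e j / A e p)) = 0" by blast
    \<comment> \<open>The eliminated unknown \<open>p\<close> is recovered from equation
      \<open>e\<close>; the coefficients passed to the induction hypothesis were corrected
      accordingly.\<close>
    define b where "b = (\<lambda>j. if j = p then - (\<Sum>j\<in>?J. a j * A e j) / A e p else a j)"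
    have sum: "(\<Sum>j\<in>J. b j * A e' j) = (\<Sum>j\<in>?J. a j * (A e' j - A e' p * A e j / A e p))" for e'
    proof -
      have "(\<Sum>j\<in>J. b j * A e' j) = b p * A e' p + (\<Sum>j\<in>?J. b j * A e' j)"
        using Cons.prems p by (simp add: sum.remove)
      also have "(\<Sum>j\<in>?J. b j * A e' j) = (\<Sum>j\<in>?J. a j * A e' j)"
        by (intro sum.cong) (auto simp: b_def)
      also have "b p * A e' p = - (\<Sum>j\<in>?J. a j * (A e' p * A e j / A e p))"
        by (simp add: b_def sum_distrib_right sum_distrib_left sum_divide_distrib mult_ac)
      finally show ?thesis by (simp add: right_diff_distrib sum_subtractf)
    qed
    have "(\<Sum>j\<in>J. b j * A e' j) = 0" if "e' \<in> set (e # es)" for e'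
    proof (cases "e' = e")
      case True
      show ?thesis unfolding sum True using p by simp
    next
      case False
      with that a(2) show ?thesis unfolding sum by simp
    qed
    moreover have "\<exists>j\<in>J. b j \<noteq> 0" using a(1) by (auto simp: b_def)
    ultimately show ?thesis by blast
  qed
qed

text \<open>The middle piece needs a sine and a cosine condition for each of n + 1 + 2 m powers,
  each end piece needs \<open>r\<close> moments. The factor 3 is the cost of (u + v + w)^2 <= 3 (u^2
  + v^2 + w^2). Membership of the products in \<open>supp_L2\<close> makes the conditions linear on
  finite combinations.\<close>

lemma outside_energy_finite_codim:
  fixes c :: real and n m r :: nat
  assumes c: "4 \<le> c" and n: "0 < n" "real n \<le> 2 * ln (c - 1) * real m"
  defines "\<epsilon> \<equiv> exp (2 * pi - pi\<^sup>2 * real n / (4 * ln (c - 1)))"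
  defines "\<gamma> \<equiv> 2 * ((2 * pi) ^ r / fact r)"
  shows "\<exists>\<Theta>. length \<Theta> = 2 * (n + 1 + 2 * m) + 2 * r \<and>
    (\<forall>\<theta>\<in>set \<Theta>. \<forall>f\<in>supp_L2 c. (\<lambda>x. \<theta> x * f x) \<in> supp_L2 c) \<and>
    (\<forall>f\<in>supp_L2 c. (\<forall>\<theta>\<in>set \<Theta>. (\<integral>x. \<theta> x * f x \<partial>lborel) = 0) \<longrightarrow>
      (\<integral>y. indicator (- {0<..<c}) y * (bandlimit f y)\<^sup>2 \<partial>lborel)
         \<le> 3 * max (\<epsilon> ^ 4) \<gamma> * (\<integral>x. (f x)\<^sup>2 \<partial>lborel))"
proof -
  let ?k = "n + 1 + 2 * m"
  obtain N D :: "real poly" where deg: "degree N \<le> ?k" "degree D \<le> ?k"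
    and in_E: "\<forall>x. 2 \<le> x \<and> x \<le> c - 2 \<longrightarrow> poly D x \<noteq> 0 \<and> \<bar>poly N x / poly D x\<bar> \<le> \<epsilon>"
    and in_F: "\<forall>y. y \<le> 0 \<or> c \<le> y \<longrightarrow> poly N y \<noteq> 0 \<and> \<bar>poly D y / poly N y\<bar> \<le> \<epsilon>"
    using separating_polynomials[OF c n] unfolding \<epsilon>_def by blast
  have ND: "poly D x \<noteq> 0 \<and> \<bar>poly N x / poly D x\<bar> \<le> \<epsilon>" if "x \<in> {2..c-2}" for x
    using in_E that by (metis atLeastAtMost_iff)
  have NDF: "poly N y \<noteq> 0 \<and> \<bar>poly D y / poly N y\<bar> \<le> \<epsilon>" if "y \<in> - {0<..<c}" for y
    using in_F that by (metis Compl_iff greaterThanLessThan_iff not_less)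
  have pm [measurable]: "poly p \<in> borel_measurable borel" for p :: "real poly"
    by (intro borel_measurable_continuous_onI continuous_intros)
  \<comment> \<open>\<open>E\<close>, \<open>G1\<close>, \<open>G2\<close> partition (0, c), with
    \<open>4 \<le> c\<close> keeping them disjoint. Building the indicators into the test functions
    turns a condition on \<open>f\<close> into one on a single piece.\<close>
  define E where "E = {2..c-2}"
  define G1 where "G1 = {0<..<2::real}"
  define G2 where "G2 = {c-2<..<c}"
  have [measurable]: "E \<in> sets borel" "G1 \<in> sets borel" "G2 \<in> sets borel" by (auto simp: E_def G1_def G2_def)
  define T1 where "T1 = (\<lambda>i x. sin (pi * x) * x ^ i / poly D x * indicator E x :: real)"
  define T2 where "T2 = (\<lambda>i x. cos (pi * x) * x ^ i / poly D x * indicator E x :: real)"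
  define T3 where "T3 = (\<lambda>j x. x ^ j * indicator G1 x :: real)"
  define T4 where "T4 = (\<lambda>j x. x ^ j * indicator G2 x :: real)"
  define \<Theta> where "\<Theta> = map T1 [0..<?k] @ map T2 [0..<?k] @ map T3 [0..<r] @ map T4 [0..<r]"
  have Dnz: "\<forall>x\<in>{2..c-2}. poly D x \<noteq> 0" using ND by blast
  have EL: "(\<lambda>x. indicator E x * f x) \<in> supp_L2 c" "(\<lambda>x. indicator G1 x * f x) \<in> supp_L2 c" "(\<lambda>x. indicator G2 x * f x) \<in> supp_L2 c"
    if "f \<in> supp_L2 c" for f using that by (auto intro!: supp_L2_indicator)
  have T12: "(\<lambda>x. (sin (pi * x) * x ^ i / poly D x) * (indicator E x * f x)) \<in> supp_L2 c"
     "(\<lambda>x. (cos (pi * x) * x ^ i / poly D x) * (indicator E x * f x)) \<in> supp_L2 c" if "f \<in> supp_L2 c" for f i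
    by (rule supp_L2_compact_mult[OF EL(1)[OF that] _ continuous_on_divide[OF _ _ Dnz]];
        auto intro!: continuous_intros simp: E_def)+
  have T34: "(\<lambda>x. x ^ i * (indicator G1 x * f x)) \<in> supp_L2 c"
     "(\<lambda>x. x ^ i * (indicator G2 x * f x)) \<in> supp_L2 c" if "f \<in> supp_L2 c" for f i
    by (rule supp_L2_continuous_mult[OF EL(2)[OF that]] supp_L2_continuous_mult[OF EL(3)[OF that]];
        intro continuous_intros)+
  have T: "T1 i x * y = (sin (pi * x) * x ^ i / poly D x) * (indicator E x * y)" "T2 i x * y = (cos (pi * x) * x ^ i / poly D x) * (indicator E x * y)"
     "T3 i x * y = x ^ i * (indicator G1 x * y)" "T4 i x * y = x ^ i * (indicator G2 x * y)" for i x y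
    by (simp_all add: T1_def T2_def T3_def T4_def)
  have set_T: "set \<Theta> = T1 ` {0..<?k} \<union> T2 ` {0..<?k} \<union> T3 ` {0..<r} \<union> T4 ` {0..<r}"
    by (simp only: \<Theta>_def set_append set_map set_upt Un_assoc)
  have mem: "i < ?k \<Longrightarrow> T1 i \<in> set \<Theta>" "i < ?k \<Longrightarrow> T2 i \<in> set \<Theta>" "i < r \<Longrightarrow> T3 i \<in> set \<Theta>" "i < r \<Longrightarrow> T4 i \<in> set \<Theta>" for i
    unfolding set_T by (blast intro: atLeastLessThan_iff[THEN iffD2] le0)+
  have "length \<Theta> = 2 * ?k + 2 * r" by (simp add: \<Theta>_def)
  moreover have "(\<lambda>x. \<theta> x * f x) \<in> supp_L2 c" if "\<theta> \<in> set \<Theta>" "f \<in> supp_L2 c" for \<theta> f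
    using that(1) T12[OF that(2)] T34[OF that(2)] unfolding \<Theta>_def by (auto simp only: set_append set_map Un_iff image_iff T)
  moreover have "(\<integral>y. indicator (- {0<..<c}) y * (bandlimit f y)\<^sup>2 \<partial>lborel)
         \<le> 3 * max (\<epsilon> ^ 4) \<gamma> * (\<integral>x. (f x)\<^sup>2 \<partial>lborel)"
    if f: "f \<in> supp_L2 c" and ort: "\<And>\<theta>. \<theta> \<in> set \<Theta> \<Longrightarrow> (\<integral>x. \<theta> x * f x \<partial>lborel) = 0" for f
  proof -
    let ?Y = "- {0<..<c}"
    define f1 where "f1 = (\<lambda>x. indicator E x * f x)"
    define f2 where "f2 = (\<lambda>x. indicator G1 x * f x)"
    define f3 where "f3 = (\<lambda>x. indicator G2 x * f x)"
    have fL: "f1 \<in> supp_L2 c" "f2 \<in> supp_L2 c" "f3 \<in> supp_L2 c" unfolding f1_def f2_def f3_def by (rule EL[OF f])+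
    have o1: "(\<integral>x. (sin (pi * x) * x ^ i / poly D x) * f1 x \<partial>lborel) = 0"
      "(\<integral>x. (cos (pi * x) * x ^ i / poly D x) * f1 x \<partial>lborel) = 0" if "i < ?k" for i
      using ort[OF mem(1)[OF that]] ort[OF mem(2)[OF that]] by (simp_all only: T f1_def)
    have o2: "(\<integral>x. x ^ i * f2 x \<partial>lborel) = 0" "(\<integral>x. x ^ i * f3 x \<partial>lborel) = 0" if "i < r" for i
      using ort[OF mem(3)[OF that]] ort[OF mem(4)[OF that]] by (simp_all only: T f2_def f3_def)
    have "\<epsilon> \<ge> 0" by (simp add: \<epsilon>_def)
    have e1: "(\<integral>y. indicator ?Y y * (bandlimit f1 y)\<^sup>2 \<partial>lborel) \<le> \<epsilon> ^ 4 * (\<integral>x. (f1 x)\<^sup>2 \<partial>lborel)"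
    proof (rule bandlimit_outside_middle[OF fL(1) _ deg _ ND NDF _ o1 \<open>\<epsilon> \<ge> 0\<close>])
      show "f1 x = 0" if "x \<notin> {2..c-2}" for x using that by (simp add: f1_def E_def indicator_def)
    qed auto
    have e2: "(\<integral>y. (bandlimit f2 y)\<^sup>2 \<partial>lborel) \<le> \<gamma> * (\<integral>x. (f2 x)\<^sup>2 \<partial>lborel)"
      unfolding \<gamma>_def by (rule bandlimit_energy_short_interval[OF fL(2), of 0]) (use o2 in \<open>auto simp: f2_def G1_def indicator_def\<close>)
    have e3: "(\<integral>y. (bandlimit f3 y)\<^sup>2 \<partial>lborel) \<le> \<gamma> * (\<integral>x. (f3 x)\<^sup>2 \<partial>lborel)"
      unfolding \<gamma>_def by (rule bandlimit_energy_short_interval[OF fL(3), of "c-2"]) (use o2 in \<open>auto simp: f3_def G2_def indicator_def\<close>)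
    have ind: "indicator E x + indicator G1 x + indicator G2 x = (1::real)" if "x \<in> {0<..<c}" for x
      using that c by (auto simp: E_def G1_def G2_def indicator_def)
    have split: "f = (\<lambda>x. (f1 x + f2 x) + f3 x)"
    proof
      fix x show "f x = (f1 x + f2 x) + f3 x"
        using ind[of x] supp_L2_zero[OF f, of x] unfolding f1_def f2_def f3_def distrib_right[symmetric]
        by (cases "x \<in> {0<..<c}") auto
    qed
    have bl: "bandlimit f y = bandlimit f1 y + bandlimit f2 y + bandlimit f3 y" for y
      by (subst split) (simp only: bandlimit_add[OF supp_L2_add[OF fL(1,2)] fL(3)] bandlimit_add[OF fL(1,2)])
    have sq: "(f1 x)\<^sup>2 + (f2 x)\<^sup>2 + (f3 x)\<^sup>2 = (f x)\<^sup>2" for x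
    proof -
      have "(indicator E x)\<^sup>2 + (indicator G1 x)\<^sup>2 + (indicator G2 x)\<^sup>2 = (1::real)" if "x \<in> {0<..<c}"
      proof -
        have "(indicator A x)\<^sup>2 = (indicator A x :: real)" for A by (simp add: indicator_def)
        then show ?thesis using ind[OF that] by simp
      qed
      then show ?thesis using supp_L2_zero[OF f, of x] unfolding f1_def f2_def f3_def power_mult_distrib distrib_right[symmetric]
        by (cases "x \<in> {0<..<c}") auto
    qed
    have i1: "integrable lborel (\<lambda>y. indicator ?Y y * (bandlimit f1 y)\<^sup>2)"
      using integrable_mult_indicator[OF _ integrable_bandlimit_sq[OF fL(1)], of ?Y] by simp
    note i23 = integrable_bandlimit_sq[OF fL(2)] integrable_bandlimit_sq[OF fL(3)]
    have "(\<integral>y. indicator ?Y y * (bandlimit f y)\<^sup>2 \<partial>lborel) \<le>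
       (\<integral>y. 3 * (indicator ?Y y * (bandlimit f1 y)\<^sup>2 + (bandlimit f2 y)\<^sup>2 + (bandlimit f3 y)\<^sup>2) \<partial>lborel)"
    proof (intro integral_mono integrable_mult_right Bochner_Integration.integrable_add i1 i23)
      show "integrable lborel (\<lambda>y. indicator ?Y y * (bandlimit f y)\<^sup>2)"
        using integrable_mult_indicator[OF _ integrable_bandlimit_sq[OF f], of ?Y] by simp
      fix y
      have "(u + v + w)\<^sup>2 \<le> 3 * (u\<^sup>2 + v\<^sup>2 + w\<^sup>2)" for u v w :: real
        using sum_squares_bound[of u v] sum_squares_bound[of u w] sum_squares_bound[of v w]
        by (simp add: power2_eq_square algebra_simps)
      from this[of "bandlimit f1 y" "bandlimit f2 y" "bandlimit f3 y"]
      show "indicator ?Y y * (bandlimit f y)\<^sup>2 \<le> 3 * (indicator ?Y y * (bandlimit f1 y)\<^sup>2 + (bandlimit f2 y)\<^sup>2 + (bandlimit f3 y)\<^sup>2)"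
        unfolding bl by (auto simp: indicator_def)
    qed
    also have "\<dots> = 3 * ((\<integral>y. indicator ?Y y * (bandlimit f1 y)\<^sup>2 \<partial>lborel) + (\<integral>y. (bandlimit f2 y)\<^sup>2 \<partial>lborel) + (\<integral>y. (bandlimit f3 y)\<^sup>2 \<partial>lborel))"
      using i1 i23 by simp
    also have "\<dots> \<le> 3 * (max (\<epsilon> ^ 4) \<gamma> * (\<integral>x. (f1 x)\<^sup>2 \<partial>lborel) + max (\<epsilon> ^ 4) \<gamma> * (\<integral>x. (f2 x)\<^sup>2 \<partial>lborel) + max (\<epsilon> ^ 4) \<gamma> * (\<integral>x. (f3 x)\<^sup>2 \<partial>lborel))"
      using order_trans[OF e1 mult_right_mono[of "\<epsilon> ^ 4" "max (\<epsilon> ^ 4) \<gamma>"]]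
        order_trans[OF e2 mult_right_mono[of \<gamma> "max (\<epsilon> ^ 4) \<gamma>"]]
        order_trans[OF e3 mult_right_mono[of \<gamma> "max (\<epsilon> ^ 4) \<gamma>"]]
      by (intro mult_left_mono add_mono) auto
    also have "\<dots> = 3 * max (\<epsilon> ^ 4) \<gamma> * (\<integral>x. (f1 x)\<^sup>2 + (f2 x)\<^sup>2 + (f3 x)\<^sup>2 \<partial>lborel)"
      using supp_L2_sq[OF fL(1)] supp_L2_sq[OF fL(2)] supp_L2_sq[OF fL(3)] by (simp add: algebra_simps)
    finally show ?thesis unfolding sq .
  qed
  ultimately show ?thesis by blast
qed

section \<open>Eigenfunctions and the number of eigenvalues\<close>

lemma bandlimit_symmetric:
  assumes f: "f \<in> supp_L2 c" and g: "g \<in> supp_L2 c"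
  shows "(\<integral>x. g x * bandlimit f x \<partial>lborel) = (\<integral>x. f x * bandlimit g x \<partial>lborel)"
proof -
  note [measurable] = supp_L2_measurable[OF f] supp_L2_measurable[OF g]
  have int: "integrable (lborel \<Otimes>\<^sub>M lborel) (\<lambda>(x, y). g y * (psinc (x - y) * f x))"
  proof (rule Bochner_Integration.integrable_bound)
    show "integrable (lborel \<Otimes>\<^sub>M lborel) (\<lambda>(x, y). \<bar>f x\<bar> * \<bar>g y\<bar>)"
      using supp_L2_integrable[OF f] supp_L2_integrable[OF g]
      by (intro lborel_pair.Fubini_integrable) (auto simp: abs_mult)
    show "AE p in lborel \<Otimes>\<^sub>M lborel. norm (case p of (x, y) \<Rightarrow> g y * (psinc (x - y) * f x)) \<le> norm (case p of (x, y) \<Rightarrow> \<bar>f x\<bar> * \<bar>g y\<bar>)"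
    proof (rule AE_I2)
      fix p :: "real \<times> real"
      obtain x y where p: "p = (x, y)" by fastforce
      have "\<bar>psinc (x - y)\<bar> * (\<bar>f x\<bar> * \<bar>g y\<bar>) \<le> 1 * (\<bar>f x\<bar> * \<bar>g y\<bar>)"
        by (intro mult_right_mono abs_psinc_le_1) auto
      then show "norm (case p of (x, y) \<Rightarrow> g y * (psinc (x - y) * f x)) \<le> norm (case p of (x, y) \<Rightarrow> \<bar>f x\<bar> * \<bar>g y\<bar>)"
        by (simp add: p abs_mult mult_ac)
    qed
  qed measurable
  have "(\<integral>y. g y * bandlimit f y \<partial>lborel) = (\<integral>y. (\<integral>x. g y * (psinc (x - y) * f x) \<partial>lborel) \<partial>lborel)"
    by (simp add: bandlimit_def)
  also have "\<dots> = (\<integral>x. (\<integral>y. g y * (psinc (x - y) * f x) \<partial>lborel) \<partial>lborel)"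
    by (rule lborel_pair.Fubini_integral[OF int])
  also have "\<dots> = (\<integral>x. (\<integral>y. f x * (psinc (y - x) * g y) \<partial>lborel) \<partial>lborel)"
    using psinc_minus[of "_ - _"] by (simp add: mult_ac)
  also have "\<dots> = (\<integral>x. f x * bandlimit g x \<partial>lborel)" by (simp add: bandlimit_def)
  finally show ?thesis .
qed

lemma sine_kernel_eq: "sine_kernel x y = psinc (y - x)"
  using psinc_minus[of "x - y"] by (simp add: sine_kernel_def psinc_def)

text \<open>\<open>R\<close> stands for \<open>Re\<close> or \<open>Im\<close>; either commutes with
  an integral operator whose kernel is real.\<close>

lemma sine_op_component:
  fixes R :: "complex \<Rightarrow> real"
  assumes f: "f \<in> L2_fun c" and R: "bounded_linear R" "\<And>z. \<bar>R z\<bar> \<le> cmod z" 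
  defines "u \<equiv> (\<lambda>x. indicator {0<..<c} x * R (f x))"
  shows "u \<in> supp_L2 c" "R (sine_op c f x) = bandlimit u x"
proof -
  let ?I = "{0<..<c}"
  have fm: "f \<in> borel_measurable (interval_meas c)" and fi: "integrable (interval_meas c) (\<lambda>x. (cmod (f x))\<^sup>2)"
    using f by (auto simp: L2_fun_def)
  have fm' [measurable]: "(\<lambda>x. indicator ?I x *\<^sub>R f x) \<in> borel_measurable borel"
    using fm by (subst (asm) borel_measurable_restrict_space_iff) auto
  have fi': "integrable lborel (\<lambda>x. indicator ?I x * (cmod (f x))\<^sup>2)"
    using fi by (subst (asm) integrable_restrict_space) (auto simp: mult.commute)
  have Rm: "R \<in> borel_measurable borel"
    using R(1) by (intro borel_measurable_continuous_onI linear_continuous_on)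
  have ueq: "u = (\<lambda>x. R (indicator ?I x *\<^sub>R f x))"
    by (auto simp: u_def fun_eq_iff linear_simps[OF R(1)])
  have um: "u \<in> borel_measurable borel"
    unfolding ueq using Rm by measurable
  have "integrable lborel (\<lambda>x. (u x)\<^sup>2)"
  proof (rule Bochner_Integration.integrable_bound[OF fi'])
    have "(R z)\<^sup>2 \<le> (cmod z)\<^sup>2" for z using power_mono[OF R(2)[of z], of 2] by simp
    then show "AE x in lborel. norm ((u x)\<^sup>2) \<le> norm (indicator ?I x * (cmod (f x))\<^sup>2)"
      by (auto simp: u_def indicator_def)
  qed (use um in simp)
  with um show "u \<in> supp_L2 c" unfolding supp_L2_def by (auto simp: u_def)
  have Ii: "integrable lborel (\<lambda>x. indicator ?I x :: real)" by (cases "0 \<le> c") auto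
  have int: "integrable lborel (\<lambda>y. indicator ?I y *\<^sub>R (complex_of_real (sine_kernel x y) * f y))"
  proof (rule Bochner_Integration.integrable_bound[OF Bochner_Integration.integrable_add[OF fi' Ii]])
    have "(\<lambda>y. complex_of_real (psinc (y - x)) * (indicator ?I y *\<^sub>R f y)) \<in> borel_measurable borel" by measurable
    then show "(\<lambda>y. indicator ?I y *\<^sub>R (complex_of_real (sine_kernel x y) * f y)) \<in> borel_measurable lborel"
      by (simp add: sine_kernel_eq)
    show "AE y in lborel. norm (indicator ?I y *\<^sub>R (complex_of_real (sine_kernel x y) * f y)) \<le> norm (indicator ?I y * (cmod (f y))\<^sup>2 + indicator ?I y)"
    proof (rule AE_I2)
      fix y
      have "\<bar>psinc (y - x)\<bar> * cmod (f y) \<le> 1 * cmod (f y)" by (intro mult_right_mono abs_psinc_le_1) auto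
      also have "\<dots> \<le> (cmod (f y))\<^sup>2 + 1" using abs_mult_le_squares[of "cmod (f y)" 1] by simp
      finally show "norm (indicator ?I y *\<^sub>R (complex_of_real (sine_kernel x y) * f y)) \<le> norm (indicator ?I y * (cmod (f y))\<^sup>2 + indicator ?I y)"
        by (auto simp: indicator_def norm_mult sine_kernel_eq)
    qed
  qed
  have "R (sine_op c f x) = R (\<integral>y. indicator ?I y *\<^sub>R (complex_of_real (sine_kernel x y) * f y) \<partial>lborel)"
    unfolding sine_op_def by (subst integral_restrict_space) auto
  also have "\<dots> = (\<integral>y. R (indicator ?I y *\<^sub>R (complex_of_real (sine_kernel x y) * f y)) \<partial>lborel)"
    by (rule integral_bounded_linear[OF R(1) int, symmetric])
  also have "\<dots> = bandlimit u x"
    unfolding bandlimit_def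
  proof (intro Bochner_Integration.integral_cong refl)
    fix y
    have "complex_of_real a * z = a *\<^sub>R z" for a z by (simp add: scaleR_conv_of_real)
    then show "R (indicator ?I y *\<^sub>R (complex_of_real (sine_kernel x y) * f y)) = psinc (y - x) * u y"
      by (simp add: u_def sine_kernel_eq linear_scale[OF bounded_linear.linear[OF R(1)]])
  qed
  finally show "R (sine_op c f x) = bandlimit u x" .
qed

text \<open>For a real eigenvalue the real and imaginary parts both satisfy the eigenvalue equation,
  and one of them is not almost everywhere zero; it is then normalised.\<close>

lemma real_eigenfunction:
  assumes "sine_eigenvalue c (complex_of_real \<mu>)"
  shows "\<exists>u\<in>supp_L2 c. (\<integral>x. (u x)\<^sup>2 \<partial>lborel) = 1 \<and> (AE x in lborel. x \<in> {0<..<c} \<longrightarrow> bandlimit u x = \<mu> * u x)"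
proof -
  let ?I = "{0<..<c}"
  obtain f where f: "f \<in> L2_fun c" "\<not> (AE x in interval_meas c. f x = 0)"
    "AE x in interval_meas c. sine_op c f x = complex_of_real \<mu> * f x"
    using assms unfolding sine_eigenvalue_def by blast
  have ev: "AE x in lborel. x \<in> ?I \<longrightarrow> sine_op c f x = complex_of_real \<mu> * f x"
    using f(3) by (subst (asm) AE_restrict_space_iff) auto
  have nz: "\<not> (AE x in lborel. x \<in> ?I \<longrightarrow> f x = 0)"
    using f(2) by (subst (asm) AE_restrict_space_iff) auto
  define U where "U = (\<lambda>(R :: complex \<Rightarrow> real) x. indicator ?I x * R (f x))"
  have L: "U Re \<in> supp_L2 c" "U Im \<in> supp_L2 c" "Re (sine_op c f x) = bandlimit (U Re) x" "Im (sine_op c f x) = bandlimit (U Im) x" for x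
    unfolding U_def
    by (rule sine_op_component[OF f(1)], rule bounded_linear_Re bounded_linear_Im, simp add: abs_Re_le_cmod abs_Im_le_cmod)+
  have E: "AE x in lborel. x \<in> ?I \<longrightarrow> bandlimit (U Re) x = \<mu> * U Re x" "AE x in lborel. x \<in> ?I \<longrightarrow> bandlimit (U Im) x = \<mu> * U Im x"
    unfolding L(3,4)[symmetric] using ev by (auto simp: U_def elim!: eventually_mono)
  have "\<exists>u\<in>supp_L2 c. (AE x in lborel. x \<in> ?I \<longrightarrow> bandlimit u x = \<mu> * u x) \<and> (\<integral>x. (u x)\<^sup>2 \<partial>lborel) \<noteq> 0"
  proof (rule ccontr)
    assume "\<not> ?thesis"
    then have "(\<integral>x. (U Re x)\<^sup>2 \<partial>lborel) = 0" "(\<integral>x. (U Im x)\<^sup>2 \<partial>lborel) = 0" using L(1,2) E by blast+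
    then have "AE x in lborel. (U Re x)\<^sup>2 = 0" "AE x in lborel. (U Im x)\<^sup>2 = 0"
      using integral_nonneg_eq_0_iff_AE[OF supp_L2_sq[OF L(1)]] integral_nonneg_eq_0_iff_AE[OF supp_L2_sq[OF L(2)]] by auto
    then have "AE x in lborel. x \<in> ?I \<longrightarrow> f x = 0"
      by eventually_elim (auto simp: U_def complex_eq_iff)
    with nz show False ..
  qed
  then obtain u where u: "u \<in> supp_L2 c" "AE x in lborel. x \<in> ?I \<longrightarrow> bandlimit u x = \<mu> * u x" "(\<integral>x. (u x)\<^sup>2 \<partial>lborel) \<noteq> 0"
    by blast
  define N where "N = (\<integral>x. (u x)\<^sup>2 \<partial>lborel)"
  have N: "0 < N" using u(3) by (simp add: N_def order_less_le)
  let ?u = "\<lambda>x. (1 / sqrt N) * u x"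
  have "(\<integral>x. (?u x)\<^sup>2 \<partial>lborel) = (1 / N) * (\<integral>x. (u x)\<^sup>2 \<partial>lborel)"
    using N by (simp only: power_mult_distrib) (simp add: power_divide)
  then have "(\<integral>x. (?u x)\<^sup>2 \<partial>lborel) = 1" using N by (simp add: N_def)
  moreover have "bandlimit ?u x = (1 / sqrt N) * bandlimit u x" for x
    unfolding bandlimit_def integral_mult_right_zero[symmetric] by (simp add: mult_ac)
  then have "AE x in lborel. x \<in> ?I \<longrightarrow> bandlimit ?u x = \<mu> * ?u x"
    using u(2) by (auto elim!: eventually_mono)
  ultimately show ?thesis using supp_L2_scale[OF u(1), of "1 / sqrt N"] by (intro bexI[of _ ?u] conjI)
qed

lemma eigenfunctions_orthogonal:
  assumes u: "u \<in> supp_L2 c" "AE x in lborel. x \<in> {0<..<c} \<longrightarrow> bandlimit u x = \<mu> * u x"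
    and v: "v \<in> supp_L2 c" "AE x in lborel. x \<in> {0<..<c} \<longrightarrow> bandlimit v x = \<nu> * v x"
    and ne: "\<mu> \<noteq> \<nu>"
  shows "(\<integral>x. u x * v x \<partial>lborel) = 0"
proof -
  note [measurable] = supp_L2_measurable[OF u(1)] supp_L2_measurable[OF v(1)] borel_measurable_bandlimit[OF u(1)] borel_measurable_bandlimit[OF v(1)]
  have "(\<integral>x. v x * bandlimit u x \<partial>lborel) = (\<integral>x. \<mu> * (u x * v x) \<partial>lborel)"
    by (rule integral_cong_AE) (use u(2) supp_L2_zero[OF v(1)] in \<open>auto elim!: eventually_mono\<close>)
  moreover have "(\<integral>x. u x * bandlimit v x \<partial>lborel) = (\<integral>x. \<nu> * (u x * v x) \<partial>lborel)"
    by (rule integral_cong_AE) (use v(2) supp_L2_zero[OF u(1)] in \<open>auto elim!: eventually_mono\<close>)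
  ultimately have "\<mu> * (\<integral>x. u x * v x \<partial>lborel) = \<nu> * (\<integral>x. u x * v x \<partial>lborel)"
    using bandlimit_symmetric[OF u(1) v(1)] by (simp only: integral_mult_right_zero)
  then have "(\<mu> - \<nu>) * (\<integral>x. u x * v x \<partial>lborel) = 0" unfolding left_diff_distrib by (simp only: diff_self)
  with ne show ?thesis by simp
qed

lemma integral_orthonormal_sum:
  fixes a b :: "'i \<Rightarrow> real"
  assumes M: "finite M" and u: "\<And>i. i \<in> M \<Longrightarrow> u i \<in> supp_L2 c"
    and on: "\<And>i j. i \<in> M \<Longrightarrow> j \<in> M \<Longrightarrow> (\<integral>x. u i x * u j x \<partial>lborel) = (if i = j then 1 else 0)"
  shows "(\<integral>x. (\<Sum>i\<in>M. a i * u i x) * (\<Sum>i\<in>M. b i * u i x) \<partial>lborel) = (\<Sum>i\<in>M. a i * b i)"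
proof -
  have "(\<integral>x. (\<Sum>i\<in>M. a i * u i x) * (\<Sum>i\<in>M. b i * u i x) \<partial>lborel)
     = (\<integral>x. (\<Sum>i\<in>M. \<Sum>j\<in>M. (a i * b j) * (u i x * u j x)) \<partial>lborel)"
    by (simp add: sum_product mult_ac)
  also have "\<dots> = (\<Sum>i\<in>M. \<Sum>j\<in>M. (a i * b j) * (\<integral>x. u i x * u j x \<partial>lborel))"
    using supp_L2_mult_integrable[OF u u]
    by (simp add: Bochner_Integration.integral_sum integrable_mult_right)
  also have "\<dots> = (\<Sum>i\<in>M. \<Sum>j\<in>M. if i = j then a i * b j else 0)"
    by (intro sum.cong refl) (simp add: on)
  also have "\<dots> = (\<Sum>i\<in>M. a i * b i)" using M by simp
  finally show ?thesis .
qed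

lemma bandlimit_sum:
  assumes "\<And>i. i \<in> M \<Longrightarrow> u i \<in> supp_L2 c"
  shows "bandlimit (\<lambda>x. \<Sum>i\<in>M. a i * u i x) y = (\<Sum>i\<in>M. a i * bandlimit (u i) y)"
proof -
  have "bandlimit (\<lambda>x. \<Sum>i\<in>M. a i * u i x) y = (\<integral>x. (\<Sum>i\<in>M. a i * (psinc (x - y) * u i x)) \<partial>lborel)"
    unfolding bandlimit_def by (simp add: sum_distrib_left mult_ac)
  also have "\<dots> = (\<Sum>i\<in>M. a i * bandlimit (u i) y)"
    unfolding bandlimit_def using bandlimit_integrable[OF assms]
    by (simp add: Bochner_Integration.integral_sum integrable_mult_right)
  finally show ?thesis .
qed

text \<open>The total energy <f, P f> involves P f only on (0, c), where it is known from the
  eigenvalue equations; it equals the sum of \<open>\<mu>\<close> times squared coefficients. The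
  energy inside gives \<open>\<mu>\<close> squared instead, and the difference is what lies
  outside.\<close>

lemma eigenspan_outside_energy:
  assumes M: "finite M" and u: "\<And>\<mu>. \<mu> \<in> M \<Longrightarrow> u \<mu> \<in> supp_L2 c" "\<And>\<mu>. \<mu> \<in> M \<Longrightarrow> (\<integral>x. (u \<mu> x)\<^sup>2 \<partial>lborel) = 1"
      "\<And>\<mu>. \<mu> \<in> M \<Longrightarrow> AE x in lborel. x \<in> {0<..<c} \<longrightarrow> bandlimit (u \<mu>) x = \<mu> * u \<mu> x"
  defines "f \<equiv> (\<lambda>a x. \<Sum>\<mu>\<in>M. a \<mu> * u \<mu> x)"
  shows "(\<integral>x. (f a x)\<^sup>2 \<partial>lborel) = (\<Sum>\<mu>\<in>M. (a \<mu>)\<^sup>2)"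
    and "(\<integral>y. indicator (- {0<..<c}) y * (bandlimit (f a) y)\<^sup>2 \<partial>lborel) = (\<Sum>\<mu>\<in>M. (\<mu> - \<mu>\<^sup>2) * (a \<mu>)\<^sup>2)"
proof -
  let ?I = "{0<..<c}"
  have on: "(\<integral>x. u \<mu> x * u \<nu> x \<partial>lborel) = (if \<mu> = \<nu> then 1 else 0)" if "\<mu> \<in> M" "\<nu> \<in> M" for \<mu> \<nu>
    using u(2)[OF that(1)] eigenfunctions_orthogonal[OF u(1)[OF that(1)] u(3)[OF that(1)] u(1)[OF that(2)] u(3)[OF that(2)]]
    by (auto simp: power2_eq_square)
  have fL: "f a \<in> supp_L2 c" for a unfolding f_def using u(1) by (intro supp_L2_sum supp_L2_scale)
  note prod = integral_orthonormal_sum[OF M u(1) on, folded f_def]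
  show "(\<integral>x. (f a x)\<^sup>2 \<partial>lborel) = (\<Sum>\<mu>\<in>M. (a \<mu>)\<^sup>2)"
    using prod[of a a] by (simp add: power2_eq_square f_def)
  define b where "b = (\<lambda>\<mu>. \<mu> * a \<mu>)"
  have "AE x in lborel. \<forall>\<mu>\<in>M. x \<in> ?I \<longrightarrow> bandlimit (u \<mu>) x = \<mu> * u \<mu> x"
    using M u(3) by (intro AE_finite_allI) auto
  then have B: "AE x in lborel. x \<in> ?I \<longrightarrow> bandlimit (f a) x = f b x"
    by eventually_elim (auto simp: f_def b_def bandlimit_sum[OF u(1)] intro!: sum.cong)
  note [measurable] = supp_L2_measurable[OF fL] borel_measurable_bandlimit[OF fL]
  have "(\<integral>y. (bandlimit (f a) y)\<^sup>2 \<partial>lborel) = (\<integral>x. f a x * bandlimit (f a) x \<partial>lborel)"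
    by (rule integral_bandlimit_sq[OF fL])
  also have "\<dots> = (\<integral>x. f a x * f b x \<partial>lborel)"
    by (rule integral_cong_AE) (use B supp_L2_zero[OF fL] in \<open>auto elim!: eventually_mono\<close>)
  also have "\<dots> = (\<Sum>\<mu>\<in>M. a \<mu> * b \<mu>)" using prod[of a b] by (simp add: f_def)
  finally have total: "(\<integral>y. (bandlimit (f a) y)\<^sup>2 \<partial>lborel) = (\<Sum>\<mu>\<in>M. a \<mu> * b \<mu>)" .
  have "(\<integral>y. indicator ?I y * (bandlimit (f a) y)\<^sup>2 \<partial>lborel) = (\<integral>x. f b x * f b x \<partial>lborel)"
    by (rule integral_cong_AE) (use B supp_L2_zero[OF fL] in \<open>auto elim!: eventually_mono simp: indicator_def power2_eq_square\<close>)
  also have "\<dots> = (\<Sum>\<mu>\<in>M. b \<mu> * b \<mu>)" using prod[of b b] by (simp add: f_def)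
  finally have inside: "(\<integral>y. indicator ?I y * (bandlimit (f a) y)\<^sup>2 \<partial>lborel) = (\<Sum>\<mu>\<in>M. b \<mu> * b \<mu>)" .
  have "(\<integral>y. indicator (- ?I) y * (bandlimit (f a) y)\<^sup>2 \<partial>lborel) = (\<integral>y. (bandlimit (f a) y)\<^sup>2 - indicator ?I y * (bandlimit (f a) y)\<^sup>2 \<partial>lborel)"
    by (intro Bochner_Integration.integral_cong) (auto simp: indicator_def)
  also have "\<dots> = (\<Sum>\<mu>\<in>M. a \<mu> * b \<mu>) - (\<Sum>\<mu>\<in>M. b \<mu> * b \<mu>)"
    unfolding total[symmetric] inside[symmetric]
    using integrable_bandlimit_sq[OF fL] integrable_mult_indicator[OF _ integrable_bandlimit_sq[OF fL], of ?I]
    by (intro Bochner_Integration.integral_diff) auto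
  also have "\<dots> = (\<Sum>\<mu>\<in>M. (\<mu> - \<mu>\<^sup>2) * (a \<mu>)\<^sup>2)"
    unfolding sum_subtractf[symmetric] by (intro sum.cong refl) (simp add: b_def power2_eq_square algebra_simps)
  finally show "(\<integral>y. indicator (- ?I) y * (bandlimit (f a) y)\<^sup>2 \<partial>lborel) = (\<Sum>\<mu>\<in>M. (\<mu> - \<mu>\<^sup>2) * (a \<mu>)\<^sup>2)" .
qed

text \<open>With more eigenvalues than conditions, a non-zero combination of eigenfunctions meets
  all conditions; lower and upper bound for its outside energy then contradict each other.\<close>

lemma card_eigenvalues_le:
  fixes c \<delta> :: real and n m r :: nat
  assumes c: "4 \<le> c" and n: "0 < n" "real n \<le> 2 * ln (c - 1) * real m"
    and small: "3 * max (exp (2 * pi - pi\<^sup>2 * real n / (4 * ln (c - 1))) ^ 4) (2 * ((2 * pi) ^ r / fact r)) < \<delta> * (1 - \<delta>)"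
    and M: "finite M" "\<And>\<mu>. \<mu> \<in> M \<Longrightarrow> \<delta> < \<mu> \<and> \<mu> \<le> 1 - \<delta> \<and> sine_eigenvalue c (complex_of_real \<mu>)"
  shows "card M \<le> 2 * (n + 1 + 2 * m) + 2 * r"
proof (rule ccontr)
  assume "\<not> ?thesis"
  then have big: "2 * (n + 1 + 2 * m) + 2 * r < card M" by simp
  let ?\<gamma> = "3 * max (exp (2 * pi - pi\<^sup>2 * real n / (4 * ln (c - 1))) ^ 4) (2 * ((2 * pi) ^ r / fact r))"
  obtain \<Theta> where \<Theta>: "length \<Theta> = 2 * (n + 1 + 2 * m) + 2 * r"
    "\<And>\<theta> f. \<theta> \<in> set \<Theta> \<Longrightarrow> f \<in> supp_L2 c \<Longrightarrow> (\<lambda>x. \<theta> x * f x) \<in> supp_L2 c"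
    "\<And>f. f \<in> supp_L2 c \<Longrightarrow> (\<forall>\<theta>\<in>set \<Theta>. (\<integral>x. \<theta> x * f x \<partial>lborel) = 0) \<Longrightarrow>
      (\<integral>y. indicator (- {0<..<c}) y * (bandlimit f y)\<^sup>2 \<partial>lborel) \<le> ?\<gamma> * (\<integral>x. (f x)\<^sup>2 \<partial>lborel)"
    using outside_energy_finite_codim[OF c n, of r] by blast
  have "\<forall>\<mu>\<in>M. \<exists>u. u \<in> supp_L2 c \<and> (\<integral>x. (u x)\<^sup>2 \<partial>lborel) = 1 \<and> (AE x in lborel. x \<in> {0<..<c} \<longrightarrow> bandlimit u x = \<mu> * u x)"
    using M(2) real_eigenfunction by blast
  from bchoice[OF this] obtain u where u': "\<forall>\<mu>\<in>M. u \<mu> \<in> supp_L2 c \<and> (\<integral>x. (u \<mu> x)\<^sup>2 \<partial>lborel) = 1 \<and>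
      (AE x in lborel. x \<in> {0<..<c} \<longrightarrow> bandlimit (u \<mu>) x = \<mu> * u \<mu> x)" ..
  have u: "\<And>\<mu>. \<mu> \<in> M \<Longrightarrow> u \<mu> \<in> supp_L2 c" "\<And>\<mu>. \<mu> \<in> M \<Longrightarrow> (\<integral>x. (u \<mu> x)\<^sup>2 \<partial>lborel) = 1"
      "\<And>\<mu>. \<mu> \<in> M \<Longrightarrow> AE x in lborel. x \<in> {0<..<c} \<longrightarrow> bandlimit (u \<mu>) x = \<mu> * u \<mu> x"
    using u' by blast+
  have "length \<Theta> < card M" using big \<Theta>(1) by simp
  from homogeneous_system_nontrivial[OF M(1) this, of "\<lambda>\<theta> \<mu>. \<integral>x. \<theta> x * u \<mu> x \<partial>lborel"]
  obtain a where a: "\<exists>\<mu>\<in>M. a \<mu> \<noteq> 0" "\<And>\<theta>. \<theta> \<in> set \<Theta> \<Longrightarrow> (\<Sum>\<mu>\<in>M. a \<mu> * (\<integral>x. \<theta> x * u \<mu> x \<partial>lborel)) = 0" by blast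
  let ?f = "\<lambda>x. \<Sum>\<mu>\<in>M. a \<mu> * u \<mu> x"
  have fL: "?f \<in> supp_L2 c" using u(1) by (intro supp_L2_sum supp_L2_scale)
  have "(\<integral>x. \<theta> x * ?f x \<partial>lborel) = 0" if "\<theta> \<in> set \<Theta>" for \<theta>
  proof -
    have "(\<integral>x. \<theta> x * ?f x \<partial>lborel) = (\<integral>x. (\<Sum>\<mu>\<in>M. a \<mu> * (\<theta> x * u \<mu> x)) \<partial>lborel)"
      by (simp add: sum_distrib_left mult_ac)
    also have "\<dots> = (\<Sum>\<mu>\<in>M. a \<mu> * (\<integral>x. \<theta> x * u \<mu> x \<partial>lborel))"
      using supp_L2_integrable[OF \<Theta>(2)[OF that u(1)]] by (simp add: Bochner_Integration.integral_sum integrable_mult_right)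
    finally show ?thesis using a(2)[OF that] by simp
  qed
  then have "(\<integral>y. indicator (- {0<..<c}) y * (bandlimit ?f y)\<^sup>2 \<partial>lborel) \<le> ?\<gamma> * (\<integral>x. (?f x)\<^sup>2 \<partial>lborel)"
    by (intro \<Theta>(3)[OF fL]) blast
  then have "(\<Sum>\<mu>\<in>M. (\<mu> - \<mu>\<^sup>2) * (a \<mu>)\<^sup>2) \<le> ?\<gamma> * (\<Sum>\<mu>\<in>M. (a \<mu>)\<^sup>2)"
    by (simp only: eigenspan_outside_energy[OF M(1) u, of a])
  moreover have "(\<Sum>\<mu>\<in>M. (\<mu> - \<mu>\<^sup>2) * (a \<mu>)\<^sup>2) \<ge> \<delta> * (1 - \<delta>) * (\<Sum>\<mu>\<in>M. (a \<mu>)\<^sup>2)"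
    unfolding sum_distrib_left
  proof (intro sum_mono mult_right_mono)
    fix \<mu> assume "\<mu> \<in> M"
    \<comment> \<open>The product equals (mu - mu^2) - delta (1 - delta).\<close>
    from M(2)[OF this] have "0 \<le> (\<mu> - \<delta>) * (1 - \<delta> - \<mu>)" by (intro mult_nonneg_nonneg) auto
    then show "\<delta> * (1 - \<delta>) \<le> \<mu> - \<mu>\<^sup>2" by (simp add: algebra_simps power2_eq_square)
  qed auto
  ultimately have "\<delta> * (1 - \<delta>) * (\<Sum>\<mu>\<in>M. (a \<mu>)\<^sup>2) \<le> ?\<gamma> * (\<Sum>\<mu>\<in>M. (a \<mu>)\<^sup>2)" by (rule order_trans[rotated])
  moreover have "0 < (\<Sum>\<mu>\<in>M. (a \<mu>)\<^sup>2)"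
  proof -
    obtain \<mu> where "\<mu> \<in> M" "a \<mu> \<noteq> 0" using a(1) by blast
    then show ?thesis using M(1) by (intro sum_pos2[of M \<mu>]) auto
  qed
  ultimately have "\<delta> * (1 - \<delta>) \<le> ?\<gamma>" by (rule mult_right_le_imp_le)
  with small show False by linarith
qed

section \<open>The counting functions\<close>

context
  fixes c :: real
begin

definition eigenvalues_above :: "real \<Rightarrow> real set"
  where "eigenvalues_above \<mu> = {\<nu>. \<mu> < \<nu> \<and> sine_eigenvalue c (complex_of_real \<nu>)}"

text \<open>The predicate under the definite description in \<open>lam\<close>. Keeping it separate
  makes it possible to ask for which indices \<open>lam c n\<close> denotes an eigenvalue.\<close>

definition nth_eigenvalue :: "nat \<Rightarrow> real \<Rightarrow> bool"
  where "nth_eigenvalue n \<mu> \<longleftrightarrow> sine_eigenvalue c (complex_of_real \<mu>) \<and>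
    finite (eigenvalues_above \<mu>) \<and> card (eigenvalues_above \<mu>) = n"

lemma lam_eq_The: "lam c n = (THE \<mu>. nth_eigenvalue n \<mu>)"
  by (simp add: lam_def nth_eigenvalue_def eigenvalues_above_def)

lemma nth_eigenvalue_unique:
  assumes "nth_eigenvalue n \<mu>" "nth_eigenvalue n \<nu>"
  shows "\<mu> = \<nu>"
proof -
  have "\<not> \<mu> < \<nu>" if "nth_eigenvalue n \<mu>" "nth_eigenvalue n \<nu>" for \<mu> \<nu>
  proof
    assume "\<mu> < \<nu>"
    then have "eigenvalues_above \<nu> \<subset> eigenvalues_above \<mu>"
      using that by (auto simp: eigenvalues_above_def nth_eigenvalue_def)
    moreover have "finite (eigenvalues_above \<mu>)" using that by (simp add: nth_eigenvalue_def)
    ultimately have "card (eigenvalues_above \<nu>) < card (eigenvalues_above \<mu>)" by (rule psubset_card_mono[rotated])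
    then show False using that by (simp add: nth_eigenvalue_def)
  qed
  with assms show ?thesis by (meson linorder_neqE_linordered_idom)
qed

lemma nth_eigenvalue_lam: "\<exists>\<mu>. nth_eigenvalue n \<mu> \<Longrightarrow> nth_eigenvalue n (lam c n)"
  unfolding lam_eq_The by (rule theI', erule ex_ex1I) (rule nth_eigenvalue_unique)

text \<open>The least of the finitely many eigenvalues above \<open>\<mu>\<close> has exactly one
  fewer above it.\<close>

lemma nth_eigenvalue_pred:
  assumes "nth_eigenvalue (Suc n) \<mu>"
  shows "\<exists>\<nu>. nth_eigenvalue n \<nu>"
proof -
  let ?A = "eigenvalues_above \<mu>"
  have A: "finite ?A" "card ?A = Suc n" using assms by (auto simp: nth_eigenvalue_def)
  then have ne: "?A \<noteq> {}" by auto
  define \<nu> where "\<nu> = Min ?A"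
  have \<nu>: "\<nu> \<in> ?A" "\<And>x. x \<in> ?A \<Longrightarrow> \<nu> \<le> x" using A(1) ne by (auto simp: \<nu>_def)
  have "eigenvalues_above \<nu> = ?A - {\<nu>}"
    using \<nu> by (force simp: eigenvalues_above_def)
  then have "nth_eigenvalue n \<nu>"
    using A \<nu>(1) by (auto simp: nth_eigenvalue_def eigenvalues_above_def)
  then show ?thesis ..
qed

lemma nth_eigenvalue_downward: "\<exists>\<mu>. nth_eigenvalue n \<mu> \<Longrightarrow> k \<le> n \<Longrightarrow> \<exists>\<mu>. nth_eigenvalue k \<mu>"
  by (induction n) (auto simp: le_Suc_eq dest: nth_eigenvalue_pred)

text \<open>Beyond the last eigenvalue, if there were one, \<^const>\<open>lam\<close> would be constant, so that an index
  set \<open>{n. lam c n \<in> A}\<close> is either infinite, with cardinality \<open>0\<close>, or contains genuine indices only.\<close>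

lemma card_lam_le: "card {n. lam c n \<in> A} \<le> card {n. lam c n \<in> A \<and> (\<exists>\<mu>. nth_eigenvalue n \<mu>)}"
proof (cases "\<forall>n. lam c n \<in> A \<longrightarrow> (\<exists>\<mu>. nth_eigenvalue n \<mu>)")
  case True
  then have "{n. lam c n \<in> A} = {n. lam c n \<in> A \<and> (\<exists>\<mu>. nth_eigenvalue n \<mu>)}" by blast
  then show ?thesis by simp
next
  case False
  then obtain N where N: "lam c N \<in> A" "\<not> (\<exists>\<mu>. nth_eigenvalue N \<mu>)" by blast
  have "lam c n = lam c N" if "N \<le> n" for n
  proof -
    have "\<not> (\<exists>\<mu>. nth_eigenvalue n \<mu>)" using N(2) nth_eigenvalue_downward that by blast
    \<comment> \<open>Both predicates are constantly false, hence equal, so their definite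
      descriptions denote the same unspecified real.\<close>
    with N(2) have "nth_eigenvalue n = nth_eigenvalue N" by auto
    then show ?thesis unfolding lam_eq_The by simp
  qed
  then have "{N..} \<subseteq> {n. lam c n \<in> A}" using N(1) by (metis atLeast_iff mem_Collect_eq subsetI)
  then have "infinite {n. lam c n \<in> A}" using infinite_Ici infinite_super by blast
  then show ?thesis by simp
qed

text \<open>The two counting functions split the range at 1/2, and on genuine indices
  \<open>lam c\<close> is injective, so indices can be traded for distinct eigenvalues.\<close>

lemma D_count_plus_Lambda_plus_le:
  assumes \<delta>: "\<delta> < 1/2"
    and K: "\<And>M. finite M \<Longrightarrow> (\<And>\<mu>. \<mu> \<in> M \<Longrightarrow> \<delta> < \<mu> \<and> \<mu> \<le> 1 - \<delta> \<and> sine_eigenvalue c (complex_of_real \<mu>)) \<Longrightarrow> card M \<le> K"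
  shows "D_count \<delta> c + Lambda_plus \<delta> c \<le> K"
proof -
  let ?G = "\<lambda>n. \<exists>\<mu>. nth_eigenvalue n \<mu>"
  define S where "S = (\<lambda>A. {n. lam c n \<in> A \<and> ?G n})"
  \<comment> \<open>The hypothesis speaks of finite sets of eigenvalues. A uniform bound on finite
    subsets also yields finiteness of the whole index set.\<close>
  have "card T \<le> K" if T: "T \<subseteq> S {\<delta><..1-\<delta>}" "finite T" for T
  proof -
    have g: "nth_eigenvalue n (lam c n)" if "n \<in> T" for n
      using T that nth_eigenvalue_lam by (auto simp: S_def)
    have "inj_on (lam c) T" by (rule inj_onI) (metis g nth_eigenvalue_def)
    then have "card T = card (lam c ` T)" by (simp add: card_image)
    also have "\<dots> \<le> K" using T g by (intro K) (auto simp: S_def nth_eigenvalue_def)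
    finally show ?thesis .
  qed
  then have fin: "finite (S {\<delta><..1-\<delta>})" and S: "card (S {\<delta><..1-\<delta>}) \<le> K"
    using finite_if_finite_subsets_card_bdd[of "S {\<delta><..1-\<delta>}" K] by auto
  have "D_count \<delta> c = card {n. lam c n \<in> {\<delta><..1/2}}" "Lambda_plus \<delta> c = card {n. lam c n \<in> {1/2<..1-\<delta>}}"
    by (simp_all add: D_count_def Lambda_plus_def)
  then have "D_count \<delta> c + Lambda_plus \<delta> c \<le> card (S {\<delta><..1/2}) + card (S {1/2<..1-\<delta>})"
    using card_lam_le[of "{\<delta><..1/2}"] card_lam_le[of "{1/2<..1-\<delta>}"] unfolding S_def by linarith
  also have "\<dots> = card (S {\<delta><..1/2} \<union> S {1/2<..1-\<delta>})"
    using \<delta> by (intro card_Un_disjoint[symmetric] finite_subset[OF _ fin]) (auto simp: S_def)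
  also have "S {\<delta><..1/2} \<union> S {1/2<..1-\<delta>} = S {\<delta><..1-\<delta>}"
    using \<delta> by (auto simp: S_def)
  finally show ?thesis using S by linarith
qed

end

section \<open>Choice of parameters and the final estimate\<close>

lemma power_div_fact_le_exp:
  fixes x :: real
  assumes "0 \<le> x"
  shows "x ^ r / fact r \<le> exp x"
proof -
  have "(\<Sum>n\<in>{r}. x ^ n /\<^sub>R fact n) \<le> (\<Sum>n. x ^ n /\<^sub>R fact n)"
    using summable_exp_generic[of x] assms by (intro sum_le_suminf) auto
  then show ?thesis by (simp add: exp_def divide_inverse mult.commute)
qed

text \<open>The leading term comes from 2 n alone; \<open>m\<close> and \<open>r\<close> are linear
  in L, and rounding adds constants, absorbed by ln c >= 1.\<close>

lemma plunge_count_bound: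
  fixes c \<delta> :: real
  defines "L \<equiv> Log_inv \<delta>"
  assumes c: "4 \<le> c" and \<delta>: "0 < \<delta>" "\<delta> < 1/2" and L: "2 * pi * exp 20 + 7 \<le> L"
  shows "real (D_count \<delta> c) + real (Lambda_plus \<delta> c) \<le> 2 * L / pi\<^sup>2 * (ln c + ln 51) + 28 * ln c"
proof -
  define S where "S = ln (c - 1)"
  have "exp (1::real) \<le> 3" by (rule exp_le)
  then have S1: "1 \<le> S" unfolding S_def using c by (subst ln_ge_iff) auto
  have Sc: "S \<le> ln c" unfolding S_def using c by simp
  have pi2: "9 \<le> pi\<^sup>2" "pi\<^sup>2 \<le> 16"
    using power_mono[of 3 pi 2] power_mono[of pi 4 2] pi_gt3 pi_less_4 by auto
  have "0 \<le> 2 * pi * exp (20::real)" by simp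
  with L have L7: "7 \<le> L" by linarith
  have \<delta>L: "\<delta> = exp (- L)" using \<delta> by (simp add: L_def Log_inv_def ln_div)
  \<comment> \<open>Makes pi^2 n / S at least L + 36. Of the 36, up to 32 pays for 8 pi, the fourth
    power of the constant loss exp (2 pi), and the rest for the factor 6 below.\<close>
  define n where "n = nat \<lceil>S * (L + 36) / pi\<^sup>2\<rceil>"
  \<comment> \<open>The node spacing is 2 S / n, and \<open>m\<close> must be at least its inverse;
    since n / S is about L / pi^2, this is of order L without a logarithm of c.\<close>
  define m where "m = nat \<lceil>real n / (2 * S)\<rceil>"
  \<comment> \<open>A small fraction of L, so that 2 r fits into the slack left by ln 51. Factorial
    decay makes any fixed fraction sufficient once L is large.\<close>
  define r where "r = nat \<lceil>L / 10\<rceil>"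
  have pos: "0 < S * (L + 36) / pi\<^sup>2" using S1 L7 by simp
  then have n: "S * (L + 36) / pi\<^sup>2 \<le> real n" "real n \<le> S * (L + 36) / pi\<^sup>2 + 1"
    unfolding n_def by linarith+
  with pos have n0: "0 < n" by (intro gr0I) simp
  have m: "real n / (2 * S) \<le> real m" "real m \<le> real n / (2 * S) + 1"
  proof -
    have "0 \<le> real n / (2 * S)" using S1 by simp
    then show "real n / (2 * S) \<le> real m" "real m \<le> real n / (2 * S) + 1" unfolding m_def by linarith+
  qed
  have r: "L / 10 \<le> real r" "real r \<le> L / 10 + 1" using L7 unfolding r_def by linarith+
  have nm: "real n \<le> 2 * ln (c - 1) * real m" using m(1) S1 by (simp add: S_def field_simps)
  \<comment> \<open>6 is the factor 3 from splitting the energy times the 2 from 1 - delta >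
    1/2.\<close>
  have e6: "6 * exp (- 2) < (1::real)"
  proof -
    have "(5/2)\<^sup>2 \<le> exp (1::real) ^ 2" using e_approx_32 by (intro power_mono) (auto simp: abs_if split: if_splits)
    moreover have "exp (2::real) = exp 1 ^ 2" by (simp add: exp_of_nat_mult[symmetric])
    ultimately have "6 < exp (2::real)" by (simp add: power2_eq_square)
    then show ?thesis by (simp add: exp_minus field_simps)
  qed
  have half: "\<delta> / 2 < \<delta> * (1 - \<delta>)" using \<delta> by simp
  have small1: "3 * exp (2 * pi - pi\<^sup>2 * real n / (4 * ln (c - 1))) ^ 4 < \<delta> / 2"
  proof -
    have "S * (L + 36) \<le> pi\<^sup>2 * real n" using n(1) pi2 by (simp add: field_simps)
    then have "L + 36 \<le> pi\<^sup>2 * real n / S" using S1 by (simp add: field_simps)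
    then have "8 * pi - pi\<^sup>2 * real n / S \<le> - L - 2" using pi_less_4 by simp
    moreover have "exp (2 * pi - pi\<^sup>2 * real n / (4 * S)) ^ 4 = exp (8 * pi - pi\<^sup>2 * real n / S)"
      by (simp add: exp_of_nat_mult[symmetric] algebra_simps)
    ultimately have "exp (2 * pi - pi\<^sup>2 * real n / (4 * S)) ^ 4 \<le> exp (- L - 2)" by simp
    also have "\<dots> = \<delta> * exp (- 2)" unfolding \<delta>L by (simp add: exp_add[symmetric])
    finally have "6 * exp (2 * pi - pi\<^sup>2 * real n / (4 * S)) ^ 4 \<le> \<delta> * (6 * exp (- 2))" by simp
    also have "\<dots> < \<delta> * 1" using e6 \<delta> by (intro mult_strict_left_mono) auto
    finally show ?thesis unfolding S_def by simp
  qed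
  have small2: "3 * (2 * ((2 * pi) ^ r / fact r)) < \<delta> / 2"
  proof -
    \<comment> \<open>Weighting by exp 20 turns the factorial into exp (?x - 20 r). As 20 r >= 2 L
      and \<open>?x\<close> <= L - 7, the exponent is at most - L - 7; this is where the lower bound
      imposed on L originates.\<close>
    let ?x = "2 * pi * exp 20"
    have "(2 * pi) ^ r / fact r = exp (- 20 * real r) * (?x ^ r / fact r)"
      by (simp add: power_mult_distrib exp_of_nat_mult[symmetric] exp_minus mult.commute)
    also have "\<dots> \<le> exp (- 20 * real r) * exp ?x"
      by (intro mult_left_mono power_div_fact_le_exp) auto
    also have "\<dots> = exp (?x - 20 * real r)" by (simp add: exp_add[symmetric])
    also have "\<dots> \<le> exp (- L - 2 - 2)" using r(1) L by simp
    also have "\<dots> = \<delta> * exp (- 2) * exp (- 2)" unfolding \<delta>L by (simp add: exp_add[symmetric])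
    finally have "12 * ((2 * pi) ^ r / fact r) \<le> 12 * (\<delta> * exp (- 2) * exp (- 2))" by (intro mult_left_mono) auto
    also have "\<dots> = \<delta> * ((6 * exp (- 2)) * (2 * exp (- 2)))" by simp
    also have "\<dots> < \<delta> * 1"
    proof (intro mult_strict_left_mono)
      have "(6 * exp (- 2)) * (2 * exp (- 2)) \<le> (6 * exp (- 2)) * (1::real)"
        using e6 by (intro mult_left_mono) auto
      with e6 show "(6 * exp (- 2)) * (2 * exp (- 2)) < (1::real)" by linarith
    qed (use \<delta> in auto)
    finally show ?thesis by simp
  qed
  have small: "3 * max (exp (2 * pi - pi\<^sup>2 * real n / (4 * ln (c - 1))) ^ 4) (2 * ((2 * pi) ^ r / fact r)) < \<delta> * (1 - \<delta>)"
  proof -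
    have "3 * max a b < d" if "3 * a < d" "3 * b < d" for a b d :: real using that by (simp add: max_def)
    moreover note less_trans[OF small1 half] less_trans[OF small2 half]
    ultimately show ?thesis by blast
  qed
  have "D_count \<delta> c + Lambda_plus \<delta> c \<le> 2 * (n + 1 + 2 * m) + 2 * r"
    by (rule D_count_plus_Lambda_plus_le[OF \<delta>(2)], rule card_eigenvalues_le[OF c n0 nm small])
  then have "real (D_count \<delta> c + Lambda_plus \<delta> c) \<le> real (2 * (n + 1 + 2 * m) + 2 * r)"
    by (rule of_nat_mono)
  then have "real (D_count \<delta> c) + real (Lambda_plus \<delta> c) \<le> 2 * real n + 2 + 4 * real m + 2 * real r" by simp
  moreover have "real n \<le> L / pi\<^sup>2 * ln c + 4 * ln c + 1"
  proof -
    have "S * (L + 36) / pi\<^sup>2 \<le> ln c * (L + 36) / pi\<^sup>2"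
      using Sc L7 by (intro divide_right_mono mult_right_mono) auto
    also have "\<dots> = L / pi\<^sup>2 * ln c + (36 / pi\<^sup>2) * ln c" by (simp add: distrib_left add_divide_distrib mult_ac)
    also have "(36 / pi\<^sup>2) * ln c \<le> 4 * ln c"
      using pi2 Sc S1 by (intro mult_right_mono) (auto simp: divide_simps)
    finally show ?thesis using n(2) by linarith
  qed
  moreover have "4 * real m \<le> 2 * L / pi\<^sup>2 + 14"
  proof -
    have "real n / (2 * S) \<le> (S * (L + 36) / pi\<^sup>2 + 1) / (2 * S)" using n(2) S1 by (intro divide_right_mono) auto
    also have "\<dots> = (L + 36) / (2 * pi\<^sup>2) + 1 / (2 * S)" using S1 by (simp add: field_simps)
    also have "1 / (2 * S) \<le> 1 / 2" using S1 by simp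
    finally have "real m \<le> (L + 36) / (2 * pi\<^sup>2) + 3 / 2" using m(2) by linarith
    then have "4 * real m \<le> 2 * L / pi\<^sup>2 + 72 / pi\<^sup>2 + 6" by (simp add: add_divide_distrib)
    moreover have "72 / pi\<^sup>2 \<le> 8" using pi2 by (simp add: divide_simps)
    ultimately show ?thesis by linarith
  qed
  \<comment> \<open>The linear costs are 2 L / pi^2 from 4 m and L / 5 from 2 r. Since ln 51 >= 3,
    two further copies of 2 L / pi^2 are available for L / 5, and pi^2 <= 16 is enough.\<close>
  moreover have "2 * L / pi\<^sup>2 + L / 5 \<le> 2 * L / pi\<^sup>2 * ln 51"
  proof -
    have "exp (3::real) = exp 1 ^ 3" by (simp add: exp_of_nat_mult[symmetric])
    also have "\<dots> \<le> 3 ^ 3" by (intro power_mono exp_le) auto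
    finally have "3 \<le> ln (51::real)" by (subst ln_ge_iff) auto
    moreover have "0 \<le> 2 * L / pi\<^sup>2" using L7 by simp
    ultimately have "2 * L / pi\<^sup>2 * 3 \<le> 2 * L / pi\<^sup>2 * ln 51" by (intro mult_left_mono)
    moreover have "L / 5 \<le> 2 * (2 * L / pi\<^sup>2)" using pi2 L7 by (simp add: divide_simps)
    ultimately show ?thesis by linarith
  qed
  ultimately have "real (D_count \<delta> c) + real (Lambda_plus \<delta> c) \<le> 2 * L / pi\<^sup>2 * ln 51 + 2 * (L / pi\<^sup>2 * ln c) + 8 * ln c + 20"
    using r(2) by linarith
  \<comment> \<open>28 = 8 + 20: the 8 is twice the bound 4 for 36 / pi^2, the 20 collects the
    rounding constants.\<close>
  also have "\<dots> \<le> 2 * L / pi\<^sup>2 * ln 51 + 2 * (L / pi\<^sup>2 * ln c) + 28 * ln c" using Sc S1 by linarith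
  finally show ?thesis by (simp add: distrib_left add_divide_distrib mult_ac)
qed

text \<open>The two logarithms differ by - ln (1 - delta), which lies between 0 and ln 2 < 1. This
  transfers the range of L to the range in which the head-side estimate is assumed.\<close>

lemma Log_odds_bounds:
  assumes "0 < \<delta>" "\<delta> < 1/2"
  shows "Log_inv \<delta> - 1 \<le> Log_odds \<delta>" "Log_odds \<delta> \<le> Log_inv \<delta>"
proof -
  have e: "Log_odds \<delta> = ln (1 - \<delta>) + Log_inv \<delta>" using assms by (simp add: Log_odds_def Log_inv_def ln_div)
  have "ln (1 - \<delta>) \<le> 0" using assms by (simp add: ln_le_zero_iff)
  moreover have "- 1 \<le> ln (1 - \<delta>)"
  proof -
    have "exp (- 1) \<le> (1/2::real)" using exp_ge_add_one_self[of "1::real"] by (simp add: exp_minus field_simps)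
    then show ?thesis using assms by (subst ln_ge_iff) auto
  qed
  ultimately show "Log_inv \<delta> - 1 \<le> Log_odds \<delta>" "Log_odds \<delta> \<le> Log_inv \<delta>" unfolding e by auto
qed

theorem corollary1p11:
  fixes C_star c_h :: real
  assumes head_side:
    "\<And>c \<delta> :: real. 0 < c \<Longrightarrow> c_h \<le> c \<Longrightarrow> 0 < \<delta> \<Longrightarrow> \<delta> < 1/2 \<Longrightarrow>
       6 \<le> Log_odds \<delta> \<Longrightarrow> Log_odds \<delta> \<le> c powr (1/3) \<Longrightarrow>
       \<bar>real (Lambda_plus \<delta> c) - Log_inv \<delta> / pi\<^sup>2 * ln (4 * pi\<^sup>2 * c / Log_inv \<delta>)\<bar>
         \<le> C_star * (ln c + Log_inv \<delta>)"
  shows "\<exists>L0 c0 C' C2 :: real.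
    C2 = (2 * ln 51 - ln (4 * pi\<^sup>2)) / pi\<^sup>2 + C_star \<and>
    (\<forall>c \<delta>. 0 < c \<and> c0 \<le> c \<and> 0 < \<delta> \<and> \<delta> < 1/2 \<and>
        L0 \<le> Log_inv \<delta> \<and> Log_inv \<delta> \<le> c powr (1/3) \<longrightarrow>
        real (D_count \<delta> c)
          \<le> Log_inv \<delta> / pi\<^sup>2 * (ln c + ln (Log_inv \<delta>)) + C2 * Log_inv \<delta> + C' * ln c) \<and>
    (\<forall>\<eta>. 0 < \<eta> \<and> \<eta> < 1 \<longrightarrow>
      (\<exists>c0_eta C_eta :: real. \<forall>c \<delta>. 0 < c \<and> c0_eta \<le> c \<and> 0 < \<delta> \<and> \<delta> < 1/2 \<and>
          L0 \<le> Log_inv \<delta> \<and> Log_inv \<delta> \<le> c powr (1/3) \<and> Log_inv \<delta> \<le> c powr (\<eta>/2) \<longrightarrow>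
          real (D_count \<delta> c)
            \<le> (1 + \<eta>) * (Log_inv \<delta> / pi\<^sup>2) * ln c + C_eta * ln c))"
proof -
  define C2 where "C2 = (2 * ln 51 - ln (4 * pi\<^sup>2)) / pi\<^sup>2 + C_star"
  define L0 where "L0 = 2 * pi * exp 20 + 7"
  define c0 where "c0 = max 4 c_h"
  define C' where "C' = C_star + 28"
  \<comment> \<open>L >= 7 guarantees \<open>Log_odds\<close> >= 6, after the possible loss of
    1.\<close>
  have L07: "7 \<le> L0" by (simp add: L0_def)
  have first: "real (D_count \<delta> c) \<le> Log_inv \<delta> / pi\<^sup>2 * (ln c + ln (Log_inv \<delta>)) + C2 * Log_inv \<delta> + C' * ln c"
    if c: "c0 \<le> c" and \<delta>: "0 < \<delta>" "\<delta> < 1/2" and L: "L0 \<le> Log_inv \<delta>" "Log_inv \<delta> \<le> c powr (1/3)" for c \<delta>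
  proof -
    define L where "L = Log_inv \<delta>"
    have c4: "4 \<le> c" "c_h \<le> c" "0 < c" using c by (auto simp: c0_def)
    have L0: "0 < L" using L L07 by (simp add: L_def)
    have "\<bar>real (Lambda_plus \<delta> c) - L / pi\<^sup>2 * ln (4 * pi\<^sup>2 * c / L)\<bar> \<le> C_star * (ln c + L)"
      unfolding L_def using Log_odds_bounds[OF \<delta>] L L07 by (intro head_side c4 \<delta>) auto
    then have "L / pi\<^sup>2 * ln (4 * pi\<^sup>2 * c / L) - C_star * (ln c + L) \<le> real (Lambda_plus \<delta> c)" by linarith
    moreover have "ln (4 * pi\<^sup>2 * c / L) = ln (4 * pi\<^sup>2) + ln c - ln L"
      using c4 L0 by (simp add: ln_div ln_mult)
    moreover have "real (D_count \<delta> c) + real (Lambda_plus \<delta> c) \<le> 2 * L / pi\<^sup>2 * (ln c + ln 51) + 28 * ln c"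
      unfolding L_def using plunge_count_bound[OF c4(1) \<delta>] L(1) by (simp add: L0_def)
    \<comment> \<open>Subtracting the lower bound for \<open>Lambda_plus\<close> halves the
      coefficient of ln c, reverses the sign of ln L and adds the error C_star (ln c + L), which is
      shared between \<open>C2\<close> and \<open>C'\<close>.\<close>
    ultimately have "real (D_count \<delta> c) \<le> 2 * L / pi\<^sup>2 * (ln c + ln 51) + 28 * ln c
      - (L / pi\<^sup>2 * (ln (4 * pi\<^sup>2) + ln c - ln L) - C_star * (ln c + L))" by simp
    also have "\<dots> = L / pi\<^sup>2 * (ln c + ln L) + C2 * L + C' * ln c"
    proof -
      have "2 * q * (x + y) + 28 * x - (q * (z + x - w) - C_star * (x + L))
        = q * (x + w) + ((2 * y - z) * q + C_star * L) + (C_star + 28) * x" for x y z w q :: real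
        by (simp add: algebra_simps)
      from this[of "L / pi\<^sup>2" "ln c" "ln 51" "ln (4 * pi\<^sup>2)" "ln L"] show ?thesis
        unfolding C2_def C'_def by (simp add: distrib_right)
    qed
    finally show ?thesis unfolding L_def .
  qed
  have second: "\<exists>c0_eta C_eta :: real. \<forall>c \<delta>. 0 < c \<and> c0_eta \<le> c \<and> 0 < \<delta> \<and> \<delta> < 1/2 \<and>
          L0 \<le> Log_inv \<delta> \<and> Log_inv \<delta> \<le> c powr (1/3) \<and> Log_inv \<delta> \<le> c powr (\<eta>/2) \<longrightarrow>
          real (D_count \<delta> c) \<le> (1 + \<eta>) * (Log_inv \<delta> / pi\<^sup>2) * ln c + C_eta * ln c"
    if \<eta>: "0 < \<eta>" for \<eta> :: real
  \<comment> \<open>The excess \<open>\<eta>\<close> is spent in halves: one on ln L <= (eta/2) ln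
    c, the other on \<open>C2 * L\<close>, for which the exponential threshold makes |C2| at most
    (eta/2) ln c / pi^2.\<close>
  proof (rule exI[of _ "max c0 (exp (2 * pi\<^sup>2 * \<bar>C2\<bar> / \<eta>))"], rule exI[of _ C'], intro allI impI, elim conjE)
    fix c \<delta> :: real
    assume c: "max c0 (exp (2 * pi\<^sup>2 * \<bar>C2\<bar> / \<eta>)) \<le> c" and \<delta>: "0 < \<delta>" "\<delta> < 1/2"
      and L: "L0 \<le> Log_inv \<delta>" "Log_inv \<delta> \<le> c powr (1/3)" "Log_inv \<delta> \<le> c powr (\<eta>/2)" and c_pos: "0 < c"
    define L where "L = Log_inv \<delta>"
    have L0: "0 < L" using L L07 by (simp add: L_def)
    have "ln L \<le> ln (c powr (\<eta>/2))" using L(3) L0 unfolding L_def by (intro ln_mono) auto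
    then have lnL: "ln L \<le> \<eta>/2 * ln c" using c_pos by (simp add: ln_powr)
    have "2 * pi\<^sup>2 * \<bar>C2\<bar> / \<eta> \<le> ln c" using c c_pos by (simp add: ln_ge_iff)
    then have "\<bar>C2\<bar> \<le> \<eta>/2 * ln c / pi\<^sup>2" using \<eta> by (simp add: field_simps)
    then have "C2 * L \<le> (\<eta>/2 * ln c / pi\<^sup>2) * L" using L0 by (intro mult_right_mono) auto
    moreover have "L / pi\<^sup>2 * (ln c + ln L) \<le> L / pi\<^sup>2 * (ln c + \<eta>/2 * ln c)"
      using L0 lnL by (intro mult_left_mono) auto
    moreover have "real (D_count \<delta> c) \<le> L / pi\<^sup>2 * (ln c + ln L) + C2 * L + C' * ln c"
      unfolding L_def using c by (intro first \<delta> L) auto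
    ultimately have "real (D_count \<delta> c) \<le> L / pi\<^sup>2 * (ln c + \<eta>/2 * ln c) + (\<eta>/2 * ln c / pi\<^sup>2) * L + C' * ln c"
      by linarith
    also have "\<dots> = (1 + \<eta>) * (L / pi\<^sup>2) * ln c + C' * ln c" by (simp add: field_simps)
    finally show "real (D_count \<delta> c) \<le> (1 + \<eta>) * (Log_inv \<delta> / pi\<^sup>2) * ln c + C' * ln c" unfolding L_def .
  qed
  show ?thesis
    by (rule exI[of _ L0], rule exI[of _ c0], rule exI[of _ C'], rule exI[of _ C2])
      (use C2_def first second in blast)
qed

end
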